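(* Let $\mathcal{U}$ be a compact subset of $\mathcal{S}^2\cap\mathcal{O}$, where $\mathcal{O}=\{x\in\mathbb{R}^3:x_i>0\text{ for all }i\}$. Then there exist constants $c_1,c_2>0$ such that, for every $n\ge1$ and $r\ge1/\sqrt n$, there exists a coupling of Kostlan's ensemble $f_n$ with a smooth $r$-range dependent Gaussian field $f_n^{(r)}$ on $\mathcal{S}^2$ satisfying, for every $x,y\in\mathcal{U}$, $$\left|\operatorname{Cov}\left((f_n-f_n^{(r)})(x),(f_n-f_n^{(r)})(y)\right)\right|\le c_1e^{-c_2n\cdot\max\{r^2,\,d_{\mathcal{S}^2}(x,y)^2\}}$$ and $$\mathbb{E}\big[\|\nabla_{\mathcal{S}^2}(f_n-f_n^{(r)})(x)\|_2^2\big]\le c_1n\,e^{-c_2nr^2},$$ where $\nabla_{\mathcal{S}^2}$ denotes the spherical gradient.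
   Context: $\mathcal{S}^2\subset\mathbb{R}^3$ is the unit sphere with spherical distance $d_{\mathcal{S}^2}$. Kostlan's ensemble is $$f_n(x)=\sum_{|J|=n}\sqrt{\binom nJ}\,a_Jx^J,\quad J=(j_1,j_2,j_3)\in\mathbb{Z}_{\ge0}^3,\ |J|=j_1+j_2+j_3,\ \binom nJ=\tfrac{n!}{j_1!j_2!j_3!},\ x^J=x_1^{j_1}x_2^{j_2}x_3^{j_3},$$ with $a_J$ i.i.d. standard Gaussians, restricted to $\mathcal{S}^2$. A Gaussian field $f$ on $\mathcal{S}^2$ is $r$-range dependent if $\operatorname{Cov}[f(x),f(y)]=0$ for all $x,y\in\mathcal{S}^2$ with $d_{\mathcal{S}^2}(x,y)\ge r$. *)

theory Defs
  imports "HOL-Probability.Probability"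
begin

text \<open>
  Random fields on the unit sphere of \<open>\<real>\<^sup>3\<close> are maps \<open>X :: real^3 \<Rightarrow> 'w \<Rightarrow> real\<close> (point, then sample);
  only their values at points of the sphere are meaningful.
\<close>

abbreviation S2 :: "(real ^ 3) set" where
  "S2 \<equiv> sphere 0 1"

definition open_orthant :: "(real ^ 3) set" where
  "open_orthant = {x. \<forall>i. 0 < x $ i}"

definition sphere_dist :: "real ^ 3 \<Rightarrow> real ^ 3 \<Rightarrow> real" where
  "sphere_dist x y = arccos (x \<bullet> y)"


section \<open>Smooth functions and the gradient on the sphere\<close>

text \<open>\<open>C\<^sup>k\<close> functions on an open set, through iterated directional derivatives.\<close>

fun C_k :: "nat \<Rightarrow> (real ^ 3) set \<Rightarrow> (real ^ 3 \<Rightarrow> real) \<Rightarrow> bool" where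
  "C_k 0 T g \<longleftrightarrow> continuous_on T g"
| "C_k (Suc k) T g \<longleftrightarrow>
     g differentiable_on T \<and> (\<forall>v. C_k k T (\<lambda>x. frechet_derivative g (at x) v))"

text \<open>
  Smoothness on the embedded submanifold \<^term>\<open>S2\<close>: since the sphere is closed, having smooth
  local extensions around each point is the same as having one on an open neighbourhood.
\<close>

definition smooth_on_S2 :: "(real ^ 3 \<Rightarrow> real) \<Rightarrow> bool" where
  "smooth_on_S2 h \<longleftrightarrow>
     (\<exists>T g. open T \<and> S2 \<subseteq> T \<and> (\<forall>k. C_k k T g) \<and> (\<forall>x\<in>S2. g x = h x))"

text \<open>
  The spherical gradient is the tangent vector representing the differential of \<open>h\<close> along the
  sphere. The derivative within the sphere fixes a linear form only on the tangent space, so the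
  condition \<open>w \<bullet> x = 0\<close> is what makes \<open>w\<close> unique; see \<open>sphere_grad_eqI\<close>.
\<close>

definition sphere_grad :: "(real ^ 3 \<Rightarrow> real) \<Rightarrow> real ^ 3 \<Rightarrow> real ^ 3" where
  "sphere_grad h x =
     (THE w. w \<bullet> x = 0 \<and> (h has_derivative (\<lambda>v. w \<bullet> v)) (at x within S2))"

lemma sphere_grad_unique:
  fixes h :: "real ^ 3 \<Rightarrow> real"
  assumes x: "x \<in> S2"
    and w: "w \<bullet> x = 0" "(h has_derivative (\<lambda>v. w \<bullet> v)) (at x within S2)"
    and w': "w' \<bullet> x = 0" "(h has_derivative (\<lambda>v. w' \<bullet> v)) (at x within S2)"
  shows "w = w'"
proof (rule ccontr)
  assume ne: "w \<noteq> w'"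
  define u where "u = (w - w') /\<^sub>R norm (w - w')"
  have ux: "u \<bullet> x = 0" using w(1) w'(1) by (simp add: u_def inner_diff_left)
  have uu: "u \<bullet> u = 1" using ne by (simp add: u_def dot_square_norm power2_eq_square)
  have xx: "x \<bullet> x = 1" using x by (simp add: dot_square_norm)
  define c where "c = (\<lambda>t::real. cos t *\<^sub>R x + sin t *\<^sub>R u)"
  have c: "(c has_derivative (\<lambda>t. t *\<^sub>R u)) (at 0)"
    unfolding c_def by (auto intro!: derivative_eq_intros)
  have c0: "c 0 = x" by (simp add: c_def)
  have "c t \<bullet> c t = 1" for t
  proof -
    have "c t \<bullet> c t = (cos t)\<^sup>2 + (sin t)\<^sup>2"
      by (simp add: c_def inner_add_left inner_add_right xx uu ux inner_commute[of x u]
          power2_eq_square)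
    then show ?thesis by simp
  qed
  then have cS: "range c \<subseteq> S2" by (auto simp: norm_eq_1)
  have *: "((\<lambda>t. h (c t)) has_derivative (\<lambda>t. z \<bullet> (t *\<^sub>R u))) (at 0)"
    if "(h has_derivative (\<lambda>v. z \<bullet> v)) (at x within S2)" for z
  proof -
    have "(h has_derivative (\<lambda>v. z \<bullet> v)) (at (c 0) within range c)"
      using has_derivative_subset[OF that cS] by (simp add: c0)
    from has_derivative_in_compose[OF c this] show ?thesis by simp
  qed
  have "(\<lambda>t. w \<bullet> (t *\<^sub>R u)) = (\<lambda>t. w' \<bullet> (t *\<^sub>R u))"
    using has_derivative_unique[OF *[OF w(2)] *[OF w'(2)]] .
  from fun_cong[OF this, of 1] have "(w - w') \<bullet> u = 0" by (simp add: inner_diff_left)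
  then show False using ne by (simp add: u_def)
qed

lemma sphere_grad_eqI:
  assumes "x \<in> S2" "w \<bullet> x = 0" "(h has_derivative (\<lambda>v. w \<bullet> v)) (at x within S2)"
  shows "sphere_grad h x = w"
  unfolding sphere_grad_def using assms sphere_grad_unique by blast


section \<open>Gaussian fields\<close>

definition covariance :: "'w measure \<Rightarrow> ('w \<Rightarrow> real) \<Rightarrow> ('w \<Rightarrow> real) \<Rightarrow> real" where
  "covariance M X Y =
     (\<integral>\<omega>. (X \<omega> - (\<integral>\<omega>'. X \<omega>' \<partial>M)) * (Y \<omega> - (\<integral>\<omega>'. Y \<omega>' \<partial>M)) \<partial>M)"

text \<open>Degenerate (almost surely constant) variables count as Gaussian.\<close>

definition gaussian_rv :: "'w measure \<Rightarrow> ('w \<Rightarrow> real) \<Rightarrow> bool" where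
  "gaussian_rv M Y \<longleftrightarrow> Y \<in> borel_measurable M \<and>
     ((\<exists>m. AE \<omega> in M. Y \<omega> = m) \<or>
      (\<exists>m \<sigma>. 0 < \<sigma> \<and> distributed M lborel Y (normal_density m \<sigma>)))"

text \<open>
  All finite-dimensional distributions are Gaussian, expressed by finite linear combinations.
\<close>

definition gaussian_field_S2 :: "'w measure \<Rightarrow> (real ^ 3 \<Rightarrow> 'w \<Rightarrow> real) \<Rightarrow> bool" where
  "gaussian_field_S2 M X \<longleftrightarrow>
     (\<forall>F b. finite F \<longrightarrow> F \<subseteq> S2 \<longrightarrow> gaussian_rv M (\<lambda>\<omega>. \<Sum>x\<in>F. b x * X x \<omega>))"

definition smooth_field_S2 :: "'w measure \<Rightarrow> (real ^ 3 \<Rightarrow> 'w \<Rightarrow> real) \<Rightarrow> bool" where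
  "smooth_field_S2 M X \<longleftrightarrow> (\<forall>\<omega>\<in>space M. smooth_on_S2 (\<lambda>x. X x \<omega>))"

definition range_dependent_S2 :: "'w measure \<Rightarrow> (real ^ 3 \<Rightarrow> 'w \<Rightarrow> real) \<Rightarrow> real \<Rightarrow> bool" where
  "range_dependent_S2 M X r \<longleftrightarrow>
     (\<forall>x\<in>S2. \<forall>y\<in>S2. r \<le> sphere_dist x y \<longrightarrow> covariance M (X x) (X y) = 0)"


section \<open>Kostlan's ensemble\<close>

definition multi_indices :: "nat \<Rightarrow> (nat ^ 3) set" where
  "multi_indices n = {J. (\<Sum>i\<in>UNIV. J $ i) = n}"

definition multinomial :: "nat \<Rightarrow> nat ^ 3 \<Rightarrow> real" where
  "multinomial n J = fact n / (\<Prod>i\<in>UNIV. fact (J $ i))"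

definition monomial :: "nat ^ 3 \<Rightarrow> real ^ 3 \<Rightarrow> real" where
  "monomial J x = (\<Prod>i\<in>UNIV. (x $ i) ^ (J $ i))"

definition kostlan :: "nat \<Rightarrow> (nat ^ 3 \<Rightarrow> 'w \<Rightarrow> real) \<Rightarrow> real ^ 3 \<Rightarrow> 'w \<Rightarrow> real" where
  "kostlan n a x \<omega> = (\<Sum>J\<in>multi_indices n. sqrt (multinomial n J) * a J \<omega> * monomial J x)"

text \<open>
  The coefficients are linear functionals of the polynomial, so a realisation of the ensemble on a
  probability space is the same as a realisation of its coefficients.
\<close>

definition kostlan_coeffs :: "nat \<Rightarrow> 'w measure \<Rightarrow> (nat ^ 3 \<Rightarrow> 'w \<Rightarrow> real) \<Rightarrow> bool" where
  "kostlan_coeffs n M a \<longleftrightarrow>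
     prob_space.indep_vars M (\<lambda>_. borel) a (multi_indices n) \<and>
     (\<forall>J\<in>multi_indices n. distributed M lborel (a J) std_normal_density)"

lemma finite_multi_indices: "finite (multi_indices n)"
proof -
  have "multi_indices n \<subseteq> vec_lambda ` (UNIV \<rightarrow>\<^sub>E {..n})"
  proof
    fix J assume "J \<in> multi_indices n"
    then have "J $ i \<le> n" for i
      unfolding multi_indices_def using member_le_sum[of i UNIV "\<lambda>i. J $ i"] by auto
    then show "J \<in> vec_lambda ` (UNIV \<rightarrow>\<^sub>E {..n})"
      by (intro image_eqI[of _ _ "vec_nth J"]) auto
  qed
  then show ?thesis by (rule finite_subset) (intro finite_imageI finite_PiE, auto)
qed

text \<open>
  A coupling: one probability space carrying both fields. Its sample space is \<open>nat \<Rightarrow> real\<close>; any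
  pair of fields with continuous paths is determined by countably many real variables, so nothing
  is lost by fixing this type.
\<close>

definition kostlan_coupling ::
    "nat \<Rightarrow> (nat \<Rightarrow> real) measure \<Rightarrow> (nat ^ 3 \<Rightarrow> (nat \<Rightarrow> real) \<Rightarrow> real) \<Rightarrow>
     (real ^ 3 \<Rightarrow> (nat \<Rightarrow> real) \<Rightarrow> real) \<Rightarrow> real \<Rightarrow> bool" where
  "kostlan_coupling n M a g r \<longleftrightarrow>
     prob_space M \<and> kostlan_coeffs n M a \<and>
     gaussian_field_S2 M g \<and> smooth_field_S2 M g \<and> range_dependent_S2 M g r"

end

theory Submission
  imports Defs
begin

text \<open>
  Write \<open>u\<^sub>J(x) = \<surd>(n choose J) x\<^sup>J\<close>, so that the Kostlan ensemble is \<open>f\<^sub>n = \<Sum> a\<^sub>J u\<^sub>J\<close>. For \<open>x\<close> on the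
  sphere the numbers \<open>u\<^sub>J(x)\<^sup>2\<close> are the probabilities of a multinomial distribution with cell
  probabilities \<open>x\<^sub>i\<^sup>2\<close>. That distribution concentrates at \<open>J \<approx> (n x\<^sub>1\<^sup>2, n x\<^sub>2\<^sup>2, n x\<^sub>3\<^sup>2)\<close> with
  fluctuations of order \<open>\<surd>n\<close>. Read as a function of \<open>x\<close> in the open orthant, \<open>u\<^sub>J\<close> is therefore a
  bump of width about \<open>1 / \<surd>n\<close> around its peak \<open>p\<^sub>J = (\<surd>(J\<^sub>1 / n), \<surd>(J\<^sub>2 / n), \<surd>(J\<^sub>3 / n))\<close>, with Gaussian
  tails. The ensemble is thus already a sum of localised independent pieces, and a field with finite
  range arises by cutting every piece off smoothly, keeping the same coefficients:
  \<open>g(x) = \<Sum> a\<^sub>J \<chi>\<^sub>J(x) u\<^sub>J(x)\<close>, where \<open>\<chi>\<^sub>J\<close> is \<open>1\<close> near \<open>p\<^sub>J\<close> and vanishes at distance at least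
  \<open>\<rho> = r / \<pi>\<close> from \<open>p\<^sub>J\<close>. Two points at spherical distance at least \<open>r\<close> are at Euclidean distance
  at least \<open>2 \<rho>\<close>, so no \<open>\<chi>\<^sub>J\<close> is nonzero at both, and \<open>g\<close> is \<open>r\<close>-range dependent on the whole
  sphere (\<open>kostlan_coupling_local_field\<close>).

  The difference \<open>\<Sum> a\<^sub>J (1 - \<chi>\<^sub>J) u\<^sub>J\<close> has covariance \<open>\<Sum> (1 - \<chi>\<^sub>J(x)) (1 - \<chi>\<^sub>J(y)) u\<^sub>J(x) u\<^sub>J(y)\<close>. In
  the orthant all terms are nonnegative, so it is at most \<open>\<Sum> u\<^sub>J(x) u\<^sub>J(y) = (x \<bullet> y) ^ n\<close>, which decays
  like \<open>exp (- c n d(x, y)\<^sup>2)\<close> (\<open>residual_covariance_distance\<close>). It is also at most the mean of two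
  multinomial probabilities, that \<open>p\<^sub>J\<close> has distance at least of order \<open>r\<close> from \<open>x\<close> under the law
  at \<open>x\<close>, and likewise for \<open>y\<close>; by the Chernoff bound both are at most a constant times
  \<open>exp (- c n r\<^sup>2)\<close> (\<open>residual_covariance_tail\<close>). The two bounds together give the maximum in the exponent.

  The expected squared gradient is the sum of the squared tangential gradients of \<open>(1 - \<chi>\<^sub>J) u\<^sub>J\<close>. The
  tangential gradient of \<open>u\<^sub>J\<close> has the components \<open>u\<^sub>J (J\<^sub>i - n x\<^sub>i\<^sup>2) / x\<^sub>i\<close>, a multinomial fluctuation,
  and its square sums over the rare indices to at most \<open>n exp (- c n r\<^sup>2)\<close> up to a constant by a
  fourth moment bound. The gradient of \<open>\<chi>\<^sub>J\<close> is of order \<open>1 / r \<le> \<surd>n\<close> and lives on the same rare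
  indices (\<open>residual_gradient_energy\<close>).
\<close>

section \<open>Smooth functions built from a flat function\<close>

text \<open>
  The standard flat function is the case \<open>m = 0\<close>; all its derivatives are linear combinations of
  this family.
\<close>

definition flat_fn :: "nat \<Rightarrow> real \<Rightarrow> real" where
  "flat_fn m t = (if t \<le> 0 then 0 else (1 / t) ^ m * exp (- (1 / t)))"

lemma flat_fn_tendsto_0: "(flat_fn m \<longlongrightarrow> 0) (at_right 0)"
proof -
  have "((\<lambda>t::real. inverse t ^ m / exp (inverse t)) \<longlongrightarrow> 0) (at_right 0)"
    by (rule filterlim_compose[OF tendsto_power_div_exp_0 filterlim_inverse_at_top_right])
  then show ?thesis
    by (rule Lim_transform_eventually)
       (auto simp: flat_fn_def eventually_at_filter exp_minus divide_inverse)
qed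

lemma flat_fn_has_derivative:
  "(flat_fn m has_real_derivative (flat_fn (m + 2) t - real m * flat_fn (m + 1) t)) (at t)"
proof (cases t "0::real" rule: linorder_cases)
  case less
  have "((\<lambda>_. 0) has_real_derivative 0) (at t)" by simp
  then have "(flat_fn m has_real_derivative 0) (at t)"
    by (rule has_field_derivative_transform_within_open[where S = "{..<0}"])
       (use less in \<open>auto simp: flat_fn_def\<close>)
  with less show ?thesis by (simp add: flat_fn_def)
next
  case greater
  have "((\<lambda>t. (1 / t) ^ m * exp (- (1 / t))) has_real_derivative
          (flat_fn (m + 2) t - real m * flat_fn (m + 1) t)) (at t)"
  proof -
    have inv: "((\<lambda>t. 1 / t) has_real_derivative - ((1 / t)\<^sup>2)) (at t)"
      using greater by (auto intro!: derivative_eq_intros simp: power2_eq_square)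
    have e: "((\<lambda>t. exp (- (1 / t))) has_real_derivative exp (- (1 / t)) * (1 / t)\<^sup>2) (at t)"
      using DERIV_chain2[OF DERIV_exp DERIV_minus[OF inv]] by simp
    show ?thesis
      using DERIV_mult[OF DERIV_power[OF inv, of m] e] greater
      by (cases m) (simp_all add: flat_fn_def power2_eq_square algebra_simps)
  qed
  then show ?thesis
    by (rule has_field_derivative_transform_within_open[where S = "{0<..}"])
       (use greater in \<open>auto simp: flat_fn_def\<close>)
next
  case equal
  have "((\<lambda>h. flat_fn m h / h) \<longlongrightarrow> 0) (at_left 0)"
    by (rule Lim_transform_eventually[OF tendsto_const])
       (auto simp: flat_fn_def eventually_at_filter)
  moreover have "((\<lambda>h. flat_fn m h / h) \<longlongrightarrow> 0) (at_right 0)"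
    by (rule Lim_transform_eventually[OF flat_fn_tendsto_0[of "Suc m"]])
       (auto simp: flat_fn_def eventually_at_filter)
  ultimately have "((\<lambda>h. flat_fn m h / h) \<longlongrightarrow> 0) (at 0)"
    by (simp add: filterlim_split_at)
  then show ?thesis using equal
    by (simp add: DERIV_def flat_fn_def)
qed

text \<open>
  To verify \<^const>\<open>C_k\<close> for all orders it suffices to have a class of differentiable functions that
  contains the directional derivatives of its members. This class has enough constructors to build
  bump functions times polynomials, and it is closed under differentiation because the family
  \<^const>\<open>flat_fn\<close> is, up to sums and constant factors.
\<close>

inductive smooth_fn :: "('a::real_inner \<Rightarrow> real) \<Rightarrow> bool" where
  const: "smooth_fn (\<lambda>x. c)"
| inner: "smooth_fn (\<lambda>x. x \<bullet> v)"
| add: "smooth_fn f \<Longrightarrow> smooth_fn g \<Longrightarrow> smooth_fn (\<lambda>x. f x + g x)"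
| mult: "smooth_fn f \<Longrightarrow> smooth_fn g \<Longrightarrow> smooth_fn (\<lambda>x. f x * g x)"
| flat: "smooth_fn f \<Longrightarrow> smooth_fn (\<lambda>x. flat_fn m (f x))"

lemma smooth_fn_derivative:
  "smooth_fn g \<Longrightarrow>
    \<exists>g'. (\<forall>x. (g has_derivative (\<lambda>v. g' v x)) (at x)) \<and> (\<forall>v. smooth_fn (g' v))"
proof (induction rule: smooth_fn.induct)
  case (const c)
  show ?case by (rule exI[of _ "\<lambda>v x. 0"]) (auto intro: smooth_fn.const)
next
  case (inner w)
  show ?case
    by (rule exI[of _ "\<lambda>v x. v \<bullet> w"]) (auto intro!: smooth_fn.const derivative_eq_intros)
next
  case (add f g)
  then obtain f' g' where "\<And>x. (f has_derivative (\<lambda>v. f' v x)) (at x)" "\<And>v. smooth_fn (f' v)"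
    "\<And>x. (g has_derivative (\<lambda>v. g' v x)) (at x)" "\<And>v. smooth_fn (g' v)" by blast
  then show ?case
    by (intro exI[of _ "\<lambda>v x. f' v x + g' v x"])
       (auto intro!: smooth_fn.intros derivative_eq_intros)
next
  case (mult f g)
  then obtain f' g' where "\<And>x. (f has_derivative (\<lambda>v. f' v x)) (at x)" "\<And>v. smooth_fn (f' v)"
    "\<And>x. (g has_derivative (\<lambda>v. g' v x)) (at x)" "\<And>v. smooth_fn (g' v)" by blast
  with mult.hyps show ?case
    by (intro exI[of _ "\<lambda>v x. f x * g' v x + f' v x * g x"])
       (auto intro!: smooth_fn.intros derivative_eq_intros)
next
  case (flat f m)
  then obtain f' where f': "\<And>x. (f has_derivative (\<lambda>v. f' v x)) (at x)" "\<And>v. smooth_fn (f' v)"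
    by blast
  have "((\<lambda>x. flat_fn m (f x)) has_derivative
          (\<lambda>v. (flat_fn (m + 2) (f x) + (- real m) * flat_fn (m + 1) (f x)) * f' v x)) (at x)" for x
    using has_derivative_compose[OF f'(1)
        flat_fn_has_derivative[unfolded has_field_derivative_def]]
    by (simp add: algebra_simps)
  moreover have
    "smooth_fn (\<lambda>x. (flat_fn (m + 2) (f x) + (- real m) * flat_fn (m + 1) (f x)) * f' v x)" for v
    by (intro smooth_fn.intros flat.hyps f'(2))
  ultimately show ?case
    by (intro exI[of _ "\<lambda>v x. (flat_fn (m + 2) (f x) + (- real m) * flat_fn (m + 1) (f x)) * f' v x"])
       auto
qed

lemma smooth_fn_sum: "(\<And>i. i \<in> I \<Longrightarrow> smooth_fn (f i)) \<Longrightarrow> smooth_fn (\<lambda>x. \<Sum>i\<in>I. f i x)"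
  by (induction I rule: infinite_finite_induct) (auto intro: smooth_fn.intros)

lemma smooth_fn_prod: "(\<And>i. i \<in> I \<Longrightarrow> smooth_fn (f i)) \<Longrightarrow> smooth_fn (\<lambda>x. \<Prod>i\<in>I. f i x)"
  by (induction I rule: infinite_finite_induct) (auto intro: smooth_fn.intros)

lemma smooth_fn_power: "smooth_fn f \<Longrightarrow> smooth_fn (\<lambda>x. f x ^ k)"
  by (induction k) (auto intro: smooth_fn.intros)

lemma smooth_fn_component: "smooth_fn (\<lambda>x::real^'n. x $ i)"
  using smooth_fn.inner[of "axis i 1 :: real^'n"] by (simp add: inner_axis)

lemma smooth_fn_dist_square: "smooth_fn (\<lambda>x::real^'n. (norm (x - p))\<^sup>2)"
proof -
  have "smooth_fn (\<lambda>x::real^'n. (x $ i - p $ i)\<^sup>2)" for i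
    using smooth_fn_power[OF smooth_fn.add[OF smooth_fn_component[of i] smooth_fn.const[of "- (p $ i)"]]]
    by simp
  then have "smooth_fn (\<lambda>x::real^'n. \<Sum>i\<in>UNIV. (x $ i - p $ i)\<^sup>2)"
    by (rule smooth_fn_sum)
  then show ?thesis
    by (simp add: norm_vec_def L2_set_def sum_nonneg)
qed

lemma smooth_fn_imp_C_k: "smooth_fn g \<Longrightarrow> C_k k UNIV g"
proof (induction k arbitrary: g)
  case 0
  then obtain g' where "\<And>x. (g has_derivative (\<lambda>v. g' v x)) (at x)"
    using smooth_fn_derivative by blast
  then show ?case
    by (auto intro!: continuous_at_imp_continuous_on has_derivative_continuous)
next
  case (Suc k)
  then obtain g' where g': "\<And>x. (g has_derivative (\<lambda>v. g' v x)) (at x)" "\<And>v. smooth_fn (g' v)"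
    using smooth_fn_derivative by blast
  have "(\<lambda>x. frechet_derivative g (at x) v) = g' v" for v
    by (rule ext) (simp flip: frechet_derivative_at[OF g'(1)])
  moreover have "g differentiable_on UNIV"
    using g'(1) unfolding differentiable_on_def differentiable_def by blast
  ultimately show ?case
    using Suc.IH g'(2) by simp
qed

lemma smooth_fn_imp_smooth_on_S2: "smooth_fn g \<Longrightarrow> smooth_on_S2 g"
  unfolding smooth_on_S2_def using smooth_fn_imp_C_k by blast

section \<open>A smooth cutoff\<close>

text \<open>
  A smooth step from \<open>1\<close> on \<open>s \<le> 1\<close> to \<open>0\<close> on \<open>s \<ge> 2\<close>, obtained from the flat function by
  composition alone: for \<open>s \<le> 1\<close> the inner value is exactly \<open>0\<close>, and for \<open>s \<ge> 2\<close> it is at least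
  \<open>exp (- 1)\<close>, so that the outer argument is nonpositive.
\<close>

definition cutoff :: "real \<Rightarrow> real" where
  "cutoff s = exp 1 * flat_fn 0 (1 - exp 1 * flat_fn 0 (s - 1))"

lemma cutoff_eq_1: "s \<le> 1 \<Longrightarrow> cutoff s = 1"
  by (simp add: cutoff_def flat_fn_def flip: exp_add)

lemma cutoff_eq_0:
  assumes "2 \<le> s"
  shows "cutoff s = 0"
proof -
  have "exp (- 1) \<le> exp (- (1 / (s - 1)))" using assms by simp
  then have "exp 1 * exp (- 1) \<le> exp 1 * flat_fn 0 (s - 1)"
    using assms by (simp add: flat_fn_def)
  then have "1 \<le> exp 1 * flat_fn 0 (s - 1)"
    by (simp flip: exp_add)
  then show ?thesis by (simp add: cutoff_def flat_fn_def)
qed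

lemma cutoff_bounds: "0 \<le> cutoff s" "cutoff s \<le> 1"
proof -
  have nonneg: "0 \<le> flat_fn 0 t" for t by (simp add: flat_fn_def)
  then show "0 \<le> cutoff s" by (simp add: cutoff_def)
  have le: "flat_fn 0 t \<le> exp (- 1)" if "t \<le> 1" for t
    using that by (simp add: flat_fn_def)
  have "flat_fn 0 (1 - exp 1 * flat_fn 0 (s - 1)) \<le> exp (- 1)"
    by (rule le) (simp add: nonneg)
  then have "cutoff s \<le> exp 1 * exp (- 1)"
    unfolding cutoff_def by (intro mult_left_mono) auto
  then show "cutoff s \<le> 1" by (simp flip: exp_add)
qed

definition cutoff_deriv :: "real \<Rightarrow> real" where
  "cutoff_deriv s = - (exp 1)\<^sup>2 * flat_fn 2 (1 - exp 1 * flat_fn 0 (s - 1)) * flat_fn 2 (s - 1)"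

lemma cutoff_has_derivative: "(cutoff has_real_derivative cutoff_deriv s) (at s)"
proof -
  have d: "(flat_fn 0 has_real_derivative flat_fn 2 t) (at t)" for t
    using flat_fn_has_derivative[of 0 t] by (simp add: numeral_2_eq_2)
  have inner: "((\<lambda>s. 1 - exp 1 * flat_fn 0 (s - 1)) has_real_derivative
      - exp 1 * flat_fn 2 (s - 1)) (at s)"
  proof -
    have "((\<lambda>s. flat_fn 0 (s - 1)) has_real_derivative flat_fn 2 (s - 1) * 1) (at s)"
      by (rule DERIV_chain2[OF d]) (auto intro!: derivative_eq_intros)
    from DERIV_diff[OF DERIV_const[of 1] DERIV_cmult[OF this, of "exp 1"]]
    show ?thesis by simp
  qed
  from DERIV_cmult[OF DERIV_chain2[OF d inner], of "exp 1"]
  show ?thesis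
    by (simp add: cutoff_def[abs_def] cutoff_deriv_def power2_eq_square mult_ac)
qed

lemma flat_fn_2_bounds: "0 \<le> flat_fn 2 t" "flat_fn 2 t \<le> 2"
proof -
  show "0 \<le> flat_fn 2 t" by (simp add: flat_fn_def)
  have "(1 / t)\<^sup>2 * exp (- (1 / t)) \<le> 2" if "0 < t"
  proof -
    have "(1 / t)\<^sup>2 / 2 \<le> exp (1 / t)"
      using exp_lower_Taylor_quadratic[of "1 / t"] that
      by (smt (verit) divide_nonneg_pos)
    then have "(1 / t)\<^sup>2 * exp (- (1 / t)) \<le> (2 * exp (1 / t)) * exp (- (1 / t))"
      by (intro mult_right_mono) auto
    also have "\<dots> = 2" by (simp add: exp_minus)
    finally show ?thesis .
  qed
  then show "flat_fn 2 t \<le> 2" by (simp add: flat_fn_def)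
qed

text \<open>
  In the region \<open>2 \<le> s\<close> the outer argument is nonpositive, which is read off from the vanishing of
  \<^const>\<open>cutoff\<close> itself.
\<close>

lemma cutoff_deriv_eq_0:
  assumes "s \<le> 1 \<or> 2 \<le> s"
  shows "cutoff_deriv s = 0"
proof (cases "s \<le> 1")
  case True
  then show ?thesis by (simp add: cutoff_deriv_def flat_fn_def)
next
  case False
  with assms have "cutoff s = 0" by (auto intro: cutoff_eq_0)
  then have "1 - exp 1 * flat_fn 0 (s - 1) \<le> 0"
    by (auto simp: cutoff_def flat_fn_def split: if_splits)
  then show ?thesis by (simp add: cutoff_deriv_def flat_fn_def)
qed

lemma abs_cutoff_deriv_le: "\<bar>cutoff_deriv s\<bar> \<le> 4 * (exp 1)\<^sup>2"
proof -
  have "\<bar>cutoff_deriv s\<bar> =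
      (exp 1)\<^sup>2 * (flat_fn 2 (1 - exp 1 * flat_fn 0 (s - 1)) * flat_fn 2 (s - 1))"
    by (simp add: cutoff_deriv_def abs_mult flat_fn_2_bounds)
  also have "\<dots> \<le> (exp 1)\<^sup>2 * (2 * 2)"
    by (intro mult_left_mono mult_mono flat_fn_2_bounds) auto
  finally show ?thesis by simp
qed

lemma smooth_fn_cutoff: "smooth_fn f \<Longrightarrow> smooth_fn (\<lambda>x. cutoff (f x))"
proof -
  assume f: "smooth_fn f"
  have "smooth_fn (\<lambda>x. exp 1 * flat_fn 0 (1 + (- exp 1) * flat_fn 0 (f x + (- 1))))"
    by (intro smooth_fn.intros f)
  then show ?thesis by (simp add: cutoff_def)
qed

section \<open>Concentration of the Kostlan basis\<close>

lemma prod_3: "(\<Prod>i\<in>(UNIV :: 3 set). f i) = f 1 * f 2 * f 3"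
  unfolding UNIV_3 by (simp add: mult.assoc)

text \<open>
  Two applications of the binomial theorem; a multi-index of weight \<open>n\<close> is determined by its first
  two entries.
\<close>

lemma multinomial_theorem:
  "(\<Sum>J\<in>multi_indices n. multinomial n J * monomial J z) = (\<Sum>i\<in>UNIV. z $ i) ^ n"
proof -
  define a b c where "a = z $ 1" and "b = z $ 2" and "c = z $ 3"
  have "(\<Sum>i\<in>UNIV. z $ i) ^ n = (a + (b + c)) ^ n"
    by (simp add: sum_3 a_def b_def c_def add.assoc)
  also have "\<dots> = (\<Sum>k\<le>n. \<Sum>l\<le>n - k.
      (of_nat (n choose k) * a ^ k) * (of_nat ((n - k) choose l) * b ^ l * c ^ (n - k - l)))"
    by (simp only: binomial_ring sum_distrib_left)
  also have "\<dots> = (\<Sum>(k, l)\<in>(SIGMA k:{..n}. {..n - k}).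
      (of_nat (n choose k) * a ^ k) * (of_nat ((n - k) choose l) * b ^ l * c ^ (n - k - l)))"
    by (rule sum.Sigma) auto
  also have "\<dots> = (\<Sum>J\<in>multi_indices n. multinomial n J * monomial J z)"
  proof (rule sum.reindex_bij_witness[where j = "\<lambda>(k, l). vector [k, l, n - k - l]"
        and i = "\<lambda>J. (J $ 1, J $ 2)"], goal_cases)
    case (1 kl)
    show ?case by (simp add: case_prod_beta)
  next
    case (2 kl)
    obtain k l where kl: "kl = (k, l)" by (cases kl)
    with 2 have "k \<le> n \<and> l \<le> n - k" by simp
    then have "k + l + (n - k - l) = n" by linarith
    then show ?case by (simp only: kl multi_indices_def sum_3 vector_3 mem_Collect_eq case_prod_conv)
  next
    case (3 J)
    then have "n - J $ 1 - J $ 2 = J $ 3" by (simp add: multi_indices_def sum_3)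
    then show ?case by (simp add: vec_eq_iff forall_3)
  next
    case (4 J)
    then show ?case by (simp add: multi_indices_def sum_3)
  next
    case (5 kl)
    obtain k l where kl: "kl = (k, l)" by (cases kl)
    with 5 have "k \<le> n" "l \<le> n - k" by simp_all
    then have "real (n choose k) = fact n / (fact k * fact (n - k))"
      "real ((n - k) choose l) = fact (n - k) / (fact l * fact (n - k - l))"
      by (simp_all only: binomial_fact)
    then have coeff: "real (n choose k) * real ((n - k) choose l) =
        fact n / (fact k * fact l * fact (n - k - l))"
      by simp
    have "multinomial n (vector [k, l, n - k - l]) = real (n choose k) * real ((n - k) choose l)"
      by (simp only: coeff multinomial_def prod_3 vector_3)
    moreover have "monomial (vector [k, l, n - k - l]) z = a ^ k * b ^ l * c ^ (n - k - l)"
      by (simp only: monomial_def prod_3 vector_3 a_def b_def c_def)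
    ultimately show ?case by (simp only: kl case_prod_conv mult_ac)
  qed
  finally show ?thesis by (rule sym)
qed

text \<open>
  The squares of these functions at a point \<open>x\<close> of the sphere form the multinomial distribution with
  cell probabilities \<open>x\<^sub>1\<^sup>2, x\<^sub>2\<^sup>2, x\<^sub>3\<^sup>2\<close>. Sums over multi-indices weighted by these squares are
  therefore expectations, and all concentration bounds below are stated in that form.
\<close>

definition kostlan_basis :: "nat \<Rightarrow> nat ^ 3 \<Rightarrow> real ^ 3 \<Rightarrow> real" where
  "kostlan_basis n J x = sqrt (multinomial n J) * monomial J x"

lemma kostlan_basis_mult:
  "kostlan_basis n J x * kostlan_basis n J y = multinomial n J * monomial J (\<chi> i. x $ i * y $ i)"
proof -
  have "0 \<le> multinomial n J" by (simp add: multinomial_def prod_nonneg)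
  then show ?thesis
    by (simp add: kostlan_basis_def monomial_def power_mult_distrib prod.distrib algebra_simps)
qed

lemma sum_kostlan_basis_mult:
  "(\<Sum>J\<in>multi_indices n. kostlan_basis n J x * kostlan_basis n J y) = (x \<bullet> y) ^ n"
  using multinomial_theorem[of n "\<chi> i. x $ i * y $ i"]
  by (simp add: kostlan_basis_mult inner_vec_def)

text \<open>
  Hoeffding's lemma for a centred Bernoulli variable. For negative \<open>h\<close> the roles of success and
  failure are exchanged.
\<close>

lemma bernoulli_exp_moment:
  fixes p h :: real
  assumes "0 \<le> p" "p \<le> 1"
  shows "exp (- h * p) * (1 - p + p * exp h) \<le> exp (h\<^sup>2 / 8)"
proof -
  have *: "exp (- h * p) * (1 - p + p * exp h) \<le> exp (h\<^sup>2 / 8)"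
    if "0 \<le> p" "p \<le> 1" "0 \<le> h" for p h :: real
  proof -
    have "1 + p * (exp h - 1) > 0"
      using that by (intro add_pos_nonneg mult_nonneg_nonneg) auto
    then have "exp (- h * p) * (1 + p * (exp h - 1)) = exp (- h * p + ln (1 + p * (exp h - 1)))"
      by (simp only: exp_add exp_ln)
    also have "\<dots> \<le> exp (h\<^sup>2 / 8)"
      using Hoeffdings_lemma_aux[of h p] that by simp
    finally show ?thesis by (simp add: algebra_simps)
  qed
  show ?thesis
  proof (cases "0 \<le> h")
    case True
    with * assms show ?thesis by blast
  next
    case False
    have "exp (- h * p) * (1 - p + p * exp h) = exp (- (- h) * (1 - p)) * (1 - (1 - p) + (1 - p) * exp (- h))"
      by (simp add: algebra_simps flip: exp_add)
    with *[of "1 - p" "- h"] False assms show ?thesis by simp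
  qed
qed

lemma S2_component_square: "x \<in> S2 \<Longrightarrow> (x $ k)\<^sup>2 \<le> 1"
  by (metis component_le_norm_cart mem_sphere_0 power2_abs power_le_one abs_ge_zero)

lemma S2_sum_squares: "x \<in> S2 \<Longrightarrow> (\<Sum>i\<in>UNIV. (x $ i)\<^sup>2) = 1"
  using dot_square_norm[of x] by (simp add: inner_vec_def power2_eq_square)

text \<open>
  Tilting one coordinate of the multinomial theorem factorises the exponential moment into \<open>n\<close>
  equal Bernoulli factors.
\<close>

lemma kostlan_exp_moment:
  assumes x: "x \<in> S2"
  shows "(\<Sum>J\<in>multi_indices n. (kostlan_basis n J x)\<^sup>2 * exp (h * (real (J $ k) - real n * (x $ k)\<^sup>2)))
    \<le> exp (real n * h\<^sup>2 / 8)"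
proof -
  define p where "p = (x $ k)\<^sup>2"
  define z :: "real ^ 3" where "z = (\<chi> i. (x $ i)\<^sup>2 * (if i = k then exp h else 1))"
  have "(kostlan_basis n J x)\<^sup>2 * exp (h * (real (J $ k) - real n * p)) =
      exp (- h * p) ^ n * (multinomial n J * monomial J z)" for J
  proof -
    have "monomial J z = monomial J (\<chi> i. x $ i * x $ i) * exp (real (J $ k) * h)"
      by (simp add: monomial_def z_def power_mult_distrib prod.distrib if_distrib[of "\<lambda>t. t ^ _"]
          prod.delta power2_eq_square exp_of_nat_mult cong: if_cong)
    then show ?thesis
      by (simp add: power2_eq_square kostlan_basis_mult algebra_simps exp_diff exp_minus
          power_inverse divide_inverse flip: exp_of_nat_mult)
  qed
  then have "(\<Sum>J\<in>multi_indices n. (kostlan_basis n J x)\<^sup>2 * exp (h * (real (J $ k) - real n * p))) =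
      (exp (- h * p) * (\<Sum>i\<in>UNIV. z $ i)) ^ n"
    by (simp add: multinomial_theorem power_mult_distrib flip: sum_distrib_left)
  also have "(\<Sum>i\<in>UNIV. z $ i) = 1 - p + p * exp h"
  proof -
    have "(\<Sum>i\<in>UNIV. z $ i) = (\<Sum>i\<in>UNIV. (x $ i)\<^sup>2 + (if i = k then p * (exp h - 1) else 0))"
      by (intro sum.cong) (auto simp: z_def p_def algebra_simps)
    then show ?thesis
      by (simp add: sum.distrib S2_sum_squares[OF x] algebra_simps)
  qed
  also have "(exp (- h * p) * (1 - p + p * exp h)) ^ n \<le> exp (h\<^sup>2 / 8) ^ n"
    using S2_component_square[OF x, of k]
    by (intro power_mono bernoulli_exp_moment mult_nonneg_nonneg add_nonneg_nonneg) (auto simp: p_def)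
  also have "\<dots> = exp (real n * h\<^sup>2 / 8)"
    by (simp flip: exp_of_nat_mult)
  finally show ?thesis by (simp add: p_def)
qed

text \<open>
  The Chernoff bound, with both signs of the exponent treated at once.
\<close>

lemma kostlan_tail:
  assumes x: "x \<in> S2" and n: "n \<ge> 1" and t: "t \<ge> 0"
  shows "(\<Sum>J\<in>multi_indices n. (kostlan_basis n J x)\<^sup>2 *
      of_bool (real n * t \<le> (real (J $ k) - real n * (x $ k)\<^sup>2)\<^sup>2)) \<le> 2 * exp (- 2 * t)"
proof -
  \<comment> \<open>The minimiser of the Chernoff exponent \<open>n h\<^sup>2 / 8 - h \<surd>(n t)\<close>.\<close>
  define h where "h = 4 * sqrt t / sqrt (real n)"
  define Y where "Y = (\<lambda>J :: nat ^ 3. real (J $ k) - real n * (x $ k)\<^sup>2)"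
  have h: "0 \<le> h" "h * sqrt (real n * t) = 4 * t" "real n * h\<^sup>2 / 8 = 2 * t"
    using n t by (simp_all add: h_def real_sqrt_mult power_mult_distrib power_divide field_simps)
  have pt: "of_bool (real n * t \<le> (Y J)\<^sup>2) \<le> exp (- 4 * t) * (exp (h * Y J) + exp ((- h) * Y J))" for J
  proof (cases "real n * t \<le> (Y J)\<^sup>2")
    case True
    then have "sqrt (real n * t) \<le> \<bar>Y J\<bar>"
      by (metis real_sqrt_abs real_sqrt_le_iff)
    then have "4 * t \<le> h * \<bar>Y J\<bar>"
      using h(1) mult_left_mono unfolding h(2)[symmetric] by blast
    then have "1 \<le> exp (- 4 * t) * exp (h * \<bar>Y J\<bar>)"
      by (simp flip: exp_add)
    also have "\<dots> \<le> exp (- 4 * t) * (exp (h * Y J) + exp ((- h) * Y J))"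
      by (intro mult_left_mono) (auto simp: abs_if)
    finally show ?thesis using True by simp
  qed (auto intro!: mult_nonneg_nonneg add_nonneg_nonneg)
  have "(\<Sum>J\<in>multi_indices n. (kostlan_basis n J x)\<^sup>2 * of_bool (real n * t \<le> (Y J)\<^sup>2))
     \<le> (\<Sum>J\<in>multi_indices n. (kostlan_basis n J x)\<^sup>2 * (exp (- 4 * t) * (exp (h * Y J) + exp ((- h) * Y J))))"
    by (intro sum_mono mult_left_mono pt) auto
  also have "\<dots> = exp (- 4 * t) *
      ((\<Sum>J\<in>multi_indices n. (kostlan_basis n J x)\<^sup>2 * exp (h * Y J)) +
       (\<Sum>J\<in>multi_indices n. (kostlan_basis n J x)\<^sup>2 * exp ((- h) * Y J)))"
    by (simp add: sum_distrib_left sum.distrib algebra_simps)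
  also have "\<dots> \<le> exp (- 4 * t) * (exp (2 * t) + exp (2 * t))"
    using kostlan_exp_moment[OF x, of n h k] kostlan_exp_moment[OF x, of n "- h" k]
    by (intro mult_left_mono add_mono) (simp_all add: Y_def h(3))
  also have "\<dots> = 2 * exp (- 2 * t)"
    by (simp add: algebra_simps flip: exp_add)
  finally show ?thesis by (simp add: Y_def)
qed

text \<open>
  The fourth moment is read off from exponential moments through this pointwise bound.
\<close>

lemma power4_le_exp: "(y::real) ^ 4 \<le> 64 * (exp y + exp (- y))"
proof -
  have *: "z ^ 4 \<le> 64 * exp z" if "0 \<le> z" for z :: real
  proof -
    have "z\<^sup>2 / 8 \<le> exp (z / 2)"
      using exp_lower_Taylor_quadratic[of "z / 2"] that by (simp add: power_divide)
    then have "(z\<^sup>2 / 8)\<^sup>2 \<le> (exp (z / 2))\<^sup>2" by (intro power_mono) auto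
    then show ?thesis by (simp add: power_divide flip: exp_double)
  qed
  show ?thesis
  proof (cases "0 \<le> y")
    case True
    from *[OF True] show ?thesis
      unfolding distrib_left by (rule add_increasing2[rotated]) simp
  next
    case False
    then have "(- y) ^ 4 \<le> 64 * exp (- y)" by (intro *) simp
    moreover have "(- y) ^ 4 = y ^ 4" by simp
    ultimately have "y ^ 4 \<le> 64 * exp (- y)" by simp
    then show ?thesis
      unfolding distrib_left by (rule add_increasing[rotated]) simp
  qed
qed

lemma kostlan_fourth_moment:
  assumes x: "x \<in> S2" and n: "n \<ge> 1"
  shows "(\<Sum>J\<in>multi_indices n. (kostlan_basis n J x)\<^sup>2 * (real (J $ k) - real n * (x $ k)\<^sup>2) ^ 4)
    \<le> 384 * (real n)\<^sup>2"
proof -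
  define h where "h = 1 / sqrt (real n)"
  define Y where "Y = (\<lambda>J :: nat ^ 3. real (J $ k) - real n * (x $ k)\<^sup>2)"
  have hn: "real n * h\<^sup>2 = 1" 
    using n by (simp add: h_def power_divide)
  then have h4: "(real n)\<^sup>2 * h ^ 4 = 1"
    by (metis (no_types, lifting) power_mult_distrib power_one power_mult numeral_Bit0 mult_2 mult.commute power_even_eq)
  have pt: "(Y J) ^ 4 \<le> (real n)\<^sup>2 * (64 * (exp (h * Y J) + exp ((- h) * Y J)))" for J
  proof -
    have "(Y J) ^ 4 = (real n)\<^sup>2 * (h * Y J) ^ 4"
      using h4 by (simp add: power_mult_distrib flip: mult.assoc)
    also have "\<dots> \<le> (real n)\<^sup>2 * (64 * (exp (h * Y J) + exp (- (h * Y J))))"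
      by (intro mult_left_mono power4_le_exp) auto
    finally show ?thesis by simp
  qed
  have "(\<Sum>J\<in>multi_indices n. (kostlan_basis n J x)\<^sup>2 * (Y J) ^ 4)
     \<le> (\<Sum>J\<in>multi_indices n. (kostlan_basis n J x)\<^sup>2 * ((real n)\<^sup>2 * (64 * (exp (h * Y J) + exp ((- h) * Y J)))))"
    by (intro sum_mono mult_left_mono pt) auto
  also have "\<dots> = (real n)\<^sup>2 * (64 *
      ((\<Sum>J\<in>multi_indices n. (kostlan_basis n J x)\<^sup>2 * exp (h * Y J)) +
       (\<Sum>J\<in>multi_indices n. (kostlan_basis n J x)\<^sup>2 * exp ((- h) * Y J))))"
    by (simp add: sum_distrib_left sum.distrib algebra_simps)
  also have "\<dots> \<le> (real n)\<^sup>2 * (64 * (exp 1 + exp 1))"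
  proof -
    have "exp (real n * h\<^sup>2 / 8) \<le> exp (1::real)" "exp (real n * (- h)\<^sup>2 / 8) \<le> exp (1::real)"
      by (simp_all add: hn)
    then show ?thesis
      using kostlan_exp_moment[OF x, of n h k] kostlan_exp_moment[OF x, of n "- h" k]
      by (intro mult_left_mono add_mono) (auto simp: Y_def intro: order_trans)
  qed
  also have "\<dots> \<le> (real n)\<^sup>2 * 384"
    using exp_le by (intro mult_left_mono) auto
  finally show ?thesis by (simp add: Y_def mult.commute)
qed

text \<open>
  A rare event keeps its exponential smallness after multiplication by the square of a coordinate's
  deviation. In place of the Cauchy--Schwarz inequality, the square is split pointwise by the
  inequality of arithmetic and geometric means into a multiple of the fourth power and a multiple of
  the indicator, with weights balanced by \<open>exp t\<close>.
\<close>

lemma kostlan_truncated_second_moment: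
  assumes x: "x \<in> S2" and n: "n \<ge> 1"
    and F: "(\<Sum>J\<in>multi_indices n. (kostlan_basis n J x)\<^sup>2 * of_bool (F J)) \<le> 6 * exp (- 2 * t)"
  shows "(\<Sum>J\<in>multi_indices n. (kostlan_basis n J x)\<^sup>2 *
      (of_bool (F J) * (real (J $ k) - real n * (x $ k)\<^sup>2)\<^sup>2)) \<le> 195 * real n * exp (- t)"
proof -
  define Y where "Y = (\<lambda>J :: nat ^ 3. real (J $ k) - real n * (x $ k)\<^sup>2)"
  let ?w = "\<lambda>J. (kostlan_basis n J x)\<^sup>2"
  have pt: "of_bool (F J) * (Y J)\<^sup>2
      \<le> (exp (- t) / (2 * real n)) * (Y J) ^ 4 + (real n * exp t / 2) * of_bool (F J)" for J
  proof (cases "F J")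
    case True
    define c where "c = exp t * real n"
    have c: "0 < c" using n by (simp add: c_def)
    have "0 \<le> ((Y J)\<^sup>2 - c)\<^sup>2 / (2 * c)" using c by simp
    also have "\<dots> = (Y J) ^ 4 / (2 * c) + c / 2 - (Y J)\<^sup>2"
      using c by (simp add: power2_diff field_simps power2_eq_square power4_eq_xxxx)
    finally show ?thesis using True
      by (simp add: c_def exp_minus field_simps)
  qed (use n in \<open>auto simp: zero_le_even_power\<close>)
  have "(\<Sum>J\<in>multi_indices n. ?w J * (of_bool (F J) * (Y J)\<^sup>2)) \<le> (\<Sum>J\<in>multi_indices n. ?w J *
      ((exp (- t) / (2 * real n)) * (Y J) ^ 4 + (real n * exp t / 2) * of_bool (F J)))"
    by (intro sum_mono mult_left_mono pt) auto
  also have "\<dots> = (exp (- t) / (2 * real n)) * (\<Sum>J\<in>multi_indices n. ?w J * (Y J) ^ 4) +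
      (real n * exp t / 2) * (\<Sum>J\<in>multi_indices n. ?w J * of_bool (F J))"
    unfolding sum_distrib_left sum.distrib[symmetric] by (intro sum.cong) (auto simp: algebra_simps)
  also have "\<dots> \<le> (exp (- t) / (2 * real n)) * (384 * (real n)\<^sup>2) +
      (real n * exp t / 2) * (6 * exp (- 2 * t))"
    using kostlan_fourth_moment[OF x n, of k] F
    by (intro add_mono mult_left_mono) (auto simp: Y_def)
  also have "\<dots> = 195 * real n * exp (- t)"
  proof -
    have "exp t * exp (- 2 * t) = exp (- t)" by (simp flip: exp_add)
    then show ?thesis using n by (simp add: power2_eq_square)
  qed
  finally show ?thesis by (simp add: Y_def)
qed

section \<open>Linear combinations of independent standard Gaussians\<close>

text \<open>
  Both fields and all their derivatives are linear combinations of the same finite family of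
  independent standard Gaussians, so covariances become inner products of coefficient vectors.
\<close>

locale standard_gaussians = prob_space M for M :: "'w measure" +
  fixes a :: "'i \<Rightarrow> 'w \<Rightarrow> real" and I :: "'i set"
  assumes finite_index: "finite I"
    and indep: "indep_vars (\<lambda>_. borel) a I"
    and std_normal: "i \<in> I \<Longrightarrow> distributed M lborel (a i) std_normal_density"
begin

lemma measurable_coeff: "i \<in> I \<Longrightarrow> a i \<in> borel_measurable M"
  using distributed_measurable[OF std_normal] by simp

lemma measurable_linear_combination: "(\<lambda>\<omega>. \<Sum>i\<in>I. c i * a i \<omega>) \<in> borel_measurable M"
  using measurable_coeff by (intro borel_measurable_sum borel_measurable_times) auto

lemma integrable_coeff: "i \<in> I \<Longrightarrow> integrable M (a i)"
  using distributed_integrable[OF std_normal, of i "\<lambda>x. x"] integrable_std_normal_moment[of 1] by simp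

lemma expectation_coeff: "i \<in> I \<Longrightarrow> expectation (a i) = 0"
  by (rule standard_normal_distributed_expectation[OF std_normal])

lemma coeff_products:
  assumes i: "i \<in> I" and j: "j \<in> I"
  shows "integrable M (\<lambda>\<omega>. a i \<omega> * a j \<omega>)" (is ?int)
    and "expectation (\<lambda>\<omega>. a i \<omega> * a j \<omega>) = of_bool (i = j)" (is ?eq)
proof -
  have "?int \<and> ?eq"
  proof (cases "i = j")
    case True
    have "integrable M (\<lambda>\<omega>. (a i \<omega>)\<^sup>2)"
      using distributed_integrable[OF std_normal[OF i], of "\<lambda>x. x\<^sup>2"] integrable_std_normal_moment[of 2]
      by simp
    moreover have "expectation (\<lambda>\<omega>. (a i \<omega>)\<^sup>2) = 1"
      using standard_normal_distributed_variance[OF std_normal[OF i]]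
      by (simp add: expectation_coeff[OF i])
    ultimately show ?thesis using True by (simp add: power2_eq_square)
  next
    case False
    have ind: "indep_vars (\<lambda>_. borel) a {i, j}"
      using i j by (intro indep_vars_subset[OF indep]) auto
    have fin: "finite {i, j}" and int: "\<And>k. k \<in> {i, j} \<Longrightarrow> integrable M (a k)"
      using i j integrable_coeff by auto
    note indep_vars_integrable[OF fin ind int] indep_vars_lebesgue_integral[OF fin ind int]
    then show ?thesis using False i j by (simp add: expectation_coeff)
  qed
  then show ?int ?eq by auto
qed

lemma expectation_linear_combination: "expectation (\<lambda>\<omega>. \<Sum>i\<in>I. c i * a i \<omega>) = 0"
  using integrable_coeff expectation_coeff by (subst Bochner_Integration.integral_sum) auto

lemma product_linear_combinations:
  shows "integrable M (\<lambda>\<omega>. (\<Sum>i\<in>I. c i * a i \<omega>) * (\<Sum>j\<in>I. d j * a j \<omega>))" (is ?int)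
    and "expectation (\<lambda>\<omega>. (\<Sum>i\<in>I. c i * a i \<omega>) * (\<Sum>j\<in>I. d j * a j \<omega>)) = (\<Sum>i\<in>I. c i * d i)" (is ?eq)
proof -
  have *: "(\<lambda>\<omega>. (\<Sum>i\<in>I. c i * a i \<omega>) * (\<Sum>j\<in>I. d j * a j \<omega>)) =
      (\<lambda>\<omega>. \<Sum>i\<in>I. \<Sum>j\<in>I. (c i * d j) * (a i \<omega> * a j \<omega>))"
    by (simp add: sum_product mult_ac)
  show ?int
    unfolding * using coeff_products(1) by (intro Bochner_Integration.integrable_sum integrable_mult_right) auto
  have "expectation (\<lambda>\<omega>. \<Sum>i\<in>I. \<Sum>j\<in>I. (c i * d j) * (a i \<omega> * a j \<omega>)) =
      (\<Sum>i\<in>I. \<Sum>j\<in>I. (c i * d j) * of_bool (i = j))"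
    using coeff_products by (simp add: Bochner_Integration.integral_sum)
  also have "\<dots> = (\<Sum>i\<in>I. c i * d i)"
  proof (rule sum.cong[OF refl])
    fix i assume "i \<in> I"
    have "(\<Sum>j\<in>I. (c i * d j) * of_bool (i = j)) = (\<Sum>j\<in>I. if i = j then c i * d j else 0)"
      by (intro sum.cong) auto
    then show "(\<Sum>j\<in>I. (c i * d j) * of_bool (i = j)) = c i * d i"
      using \<open>i \<in> I\<close> finite_index by simp
  qed
  finally show ?eq unfolding * .
qed

lemma covariance_linear_combinations:
  "covariance M (\<lambda>\<omega>. \<Sum>i\<in>I. c i * a i \<omega>) (\<lambda>\<omega>. \<Sum>i\<in>I. d i * a i \<omega>) = (\<Sum>i\<in>I. c i * d i)"
  by (simp add: covariance_def expectation_linear_combination product_linear_combinations(2))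

text \<open>
  The vanishing coefficients are discarded first because a degenerate summand has no density.
\<close>

lemma gaussian_linear_combination: "gaussian_rv M (\<lambda>\<omega>. \<Sum>i\<in>I. c i * a i \<omega>)"
proof -
  define I' where "I' = {i \<in> I. c i \<noteq> 0}"
  have eq: "(\<Sum>i\<in>I. c i * a i \<omega>) = (\<Sum>i\<in>I'. c i * a i \<omega>)" for \<omega>
    unfolding I'_def using finite_index by (intro sum.mono_neutral_right) auto
  show ?thesis
  proof (cases "I' = {}")
    case True
    then show ?thesis
      using measurable_linear_combination unfolding gaussian_rv_def by (auto simp: eq)
  next
    case False
    have "distributed M lborel (\<lambda>\<omega>. \<Sum>i\<in>I'. c i * a i \<omega>)
        (normal_density (\<Sum>i\<in>I'. 0) (sqrt (\<Sum>i\<in>I'. \<bar>c i\<bar>\<^sup>2)))"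
    proof (rule sum_indep_normal)
      show "finite I'" "I' \<noteq> {}" using finite_index False by (auto simp: I'_def)
      have "indep_vars (\<lambda>_. borel) a I'" by (rule indep_vars_subset[OF indep]) (auto simp: I'_def)
      then show "indep_vars (\<lambda>_. borel) (\<lambda>i \<omega>. c i * a i \<omega>) I'"
        by (rule indep_vars_compose2) auto
      show "0 < \<bar>c i\<bar>" if "i \<in> I'" for i using that by (simp add: I'_def)
      show "distributed M lborel (\<lambda>\<omega>. c i * a i \<omega>) (normal_density 0 \<bar>c i\<bar>)" if "i \<in> I'" for i
        using normal_density_affine[OF std_normal, of i "c i" 0] that by (simp add: I'_def)
    qed
    moreover have "0 < sqrt (\<Sum>i\<in>I'. \<bar>c i\<bar>\<^sup>2)"
      using False finite_index by (auto simp: I'_def intro!: sum_pos)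
    ultimately show ?thesis
      using measurable_linear_combination[of c] unfolding gaussian_rv_def eq by auto
  qed
qed

lemma norm_square_vector_combination:
  fixes W :: "'i \<Rightarrow> real ^ 'n"
  shows "integrable M (\<lambda>\<omega>. (norm (\<Sum>i\<in>I. a i \<omega> *\<^sub>R W i))\<^sup>2)" (is ?int)
    and "expectation (\<lambda>\<omega>. (norm (\<Sum>i\<in>I. a i \<omega> *\<^sub>R W i))\<^sup>2) = (\<Sum>i\<in>I. (norm (W i))\<^sup>2)" (is ?eq)
proof -
  have norm_sq: "(norm v)\<^sup>2 = (\<Sum>k\<in>UNIV. v $ k * v $ k)" for v :: "real ^ 'n"
    by (simp add: power2_norm_eq_inner inner_vec_def)
  have *: "(\<lambda>\<omega>. (norm (\<Sum>i\<in>I. a i \<omega> *\<^sub>R W i))\<^sup>2) =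
      (\<lambda>\<omega>. \<Sum>k\<in>UNIV. (\<Sum>i\<in>I. W i $ k * a i \<omega>) * (\<Sum>i\<in>I. W i $ k * a i \<omega>))"
    by (simp add: norm_sq mult.commute)
  show ?int
    unfolding * by (intro Bochner_Integration.integrable_sum product_linear_combinations)
  have "expectation (\<lambda>\<omega>. \<Sum>k\<in>UNIV. (\<Sum>i\<in>I. W i $ k * a i \<omega>) * (\<Sum>i\<in>I. W i $ k * a i \<omega>)) =
      (\<Sum>k\<in>UNIV. \<Sum>i\<in>I. W i $ k * W i $ k)"
    by (simp add: Bochner_Integration.integral_sum product_linear_combinations)
  also have "\<dots> = (\<Sum>i\<in>I. \<Sum>k\<in>UNIV. W i $ k * W i $ k)" by (rule sum.swap)
  finally show ?eq unfolding * by (simp only: norm_sq)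
qed

end

definition gaussian_sequence_space :: "(nat \<Rightarrow> real) measure" where
  "gaussian_sequence_space = (\<Pi>\<^sub>M i\<in>UNIV. density lborel std_normal_density)"

text \<open>
  Selecting coordinates of a product measure along an injection gives a product measure again, which
  is the independence of the selected coordinates.
\<close>

lemma standard_gaussians_coordinates:
  fixes I :: "'i::countable set"
  assumes "finite I" "I \<noteq> {}"
  shows "standard_gaussians gaussian_sequence_space (\<lambda>i \<omega>. \<omega> (to_nat i)) I"
proof -
  let ?N = "density lborel std_normal_density"
  have N: "prob_space ?N" by (rule prob_space_normal_density) simp
  interpret prob_space gaussian_sequence_space
    unfolding gaussian_sequence_space_def by (intro prob_space_PiM N)
  have sets_eq: "sets gaussian_sequence_space = sets (\<Pi>\<^sub>M i\<in>UNIV. borel)"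
    unfolding gaussian_sequence_space_def by (intro sets_PiM_cong) auto
  have meas: "random_variable borel (\<lambda>\<omega>. \<omega> k)" for k :: nat
    by (subst measurable_cong_sets[OF sets_eq refl]) simp
  have comp: "distr gaussian_sequence_space borel (\<lambda>\<omega>. \<omega> k) = ?N" for k
  proof -
    have "distr gaussian_sequence_space ?N (\<lambda>\<omega>. \<omega> k) = ?N"
      unfolding gaussian_sequence_space_def by (intro distr_PiM_component N) auto
    then show ?thesis by (simp cong: distr_cong)
  qed
  have reindex: "distr gaussian_sequence_space (\<Pi>\<^sub>M i\<in>I. ?N) (\<lambda>\<omega>. \<lambda>i\<in>I. \<omega> (to_nat i)) = (\<Pi>\<^sub>M i\<in>I. ?N)"
    unfolding gaussian_sequence_space_def
    by (rule distr_PiM_reindex[where M = "\<lambda>_. ?N"]) (auto intro: N inj_on_subset[OF inj_to_nat])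
  show ?thesis
  proof
    show "finite I" by fact
    have "distr gaussian_sequence_space (\<Pi>\<^sub>M i\<in>I. borel) (\<lambda>\<omega>. \<lambda>i\<in>I. \<omega> (to_nat i)) =
        distr gaussian_sequence_space (\<Pi>\<^sub>M i\<in>I. ?N) (\<lambda>\<omega>. \<lambda>i\<in>I. \<omega> (to_nat i))"
      by (intro distr_cong refl sets_PiM_cong) auto
    then show "indep_vars (\<lambda>_. borel) (\<lambda>i \<omega>. \<omega> (to_nat i)) I"
      using assms meas by (subst indep_vars_iff_distr_eq_PiM') (auto simp: comp reindex)
    show "distributed gaussian_sequence_space lborel (\<lambda>\<omega>. \<omega> (to_nat i)) std_normal_density" for i :: 'i
      using comp[of "to_nat i"] meas[of "to_nat i"]
      by (simp add: distributed_def cong: distr_cong)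
  qed
qed

section \<open>Distance and gradient on the sphere\<close>

text \<open>
  Concavity: on \<open>[0, \<pi> / 2]\<close> the sine lies above its chord.
\<close>

lemma jordan_sine_bound:
  assumes "0 \<le> t" "t \<le> pi / 2"
  shows "2 * t / pi \<le> sin t"
proof -
  have cvx: "convex_on {0..pi / 2} (\<lambda>x. - sin x)"
    by (rule convex_on_realI[where f' = "\<lambda>x. - cos x"])
       (auto intro!: derivative_eq_intros cos_monotone_0_pi_le)
  have "- sin ((1 - 2 * t / pi) *\<^sub>R 0 + (2 * t / pi) *\<^sub>R (pi / 2))
      \<le> (1 - 2 * t / pi) * - sin 0 + (2 * t / pi) * - sin (pi / 2)"
    using assms by (intro convex_onD_Icc[OF cvx]) (auto simp: field_simps)
  then show ?thesis by simp
qed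

lemma inner_S2_bounds:
  assumes "x \<in> S2" "y \<in> S2"
  shows "\<bar>x \<bullet> y\<bar> \<le> 1"
  using Cauchy_Schwarz_ineq2[of x y] assms by simp

lemma inner_le_sphere_dist:
  assumes "x \<in> S2" "y \<in> S2"
  shows "x \<bullet> y \<le> 1 - 2 * (sphere_dist x y)\<^sup>2 / pi\<^sup>2"
proof -
  define d where "d = sphere_dist x y"
  have b: "-1 \<le> x \<bullet> y" "x \<bullet> y \<le> 1" using inner_S2_bounds[OF assms] by auto
  then have d: "0 \<le> d" "d \<le> pi" "cos d = x \<bullet> y"
    by (auto simp: d_def sphere_dist_def arccos_lbound arccos_ubound cos_arccos)
  have "d / pi \<le> sin (d / 2)" using jordan_sine_bound[of "d / 2"] d by simp
  then have "(d / pi)\<^sup>2 \<le> (sin (d / 2))\<^sup>2" using d by (intro power_mono) auto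
  moreover have "cos d = 1 - 2 * (sin (d / 2))\<^sup>2" using cos_double_sin[of "d / 2"] by simp
  ultimately show ?thesis using d(3) by (simp add: power_divide d_def)
qed

lemma norm_diff_ge_sphere_dist:
  assumes "x \<in> S2" "y \<in> S2"
  shows "2 * sphere_dist x y / pi \<le> norm (x - y)"
proof (rule power2_le_imp_le)
  have "x \<bullet> x = 1" "y \<bullet> y = 1" using assms by (simp_all add: dot_square_norm)
  then have "(norm (x - y))\<^sup>2 = 2 - 2 * (x \<bullet> y)"
    by (simp add: power2_norm_eq_inner inner_diff_left inner_diff_right inner_commute[of y x])
  then show "(2 * sphere_dist x y / pi)\<^sup>2 \<le> (norm (x - y))\<^sup>2"
    using inner_le_sphere_dist[OF assms] by (simp add: power_divide power_mult_distrib)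
qed simp

text \<open>
  The linear form \<open>v \<mapsto> x \<bullet> v\<close> may be subtracted from a derivative within the sphere at \<open>x\<close>, since
  \<open>x \<bullet> y = 1 - \<bar>y - x\<bar>\<^sup>2 / 2\<close> for \<open>y\<close> on the sphere is stationary at \<open>y = x\<close>.
\<close>

lemma sphere_grad_eq_tangential_part:
  fixes h :: "real ^ 3 \<Rightarrow> real"
  assumes x: "x \<in> S2" and h: "(h has_derivative (\<lambda>v. G \<bullet> v)) (at x)"
  shows "sphere_grad h x = G - (G \<bullet> x) *\<^sub>R x"
proof (rule sphere_grad_eqI[OF x])
  have xx: "x \<bullet> x = 1" using x by (simp add: dot_square_norm)
  then show "(G - (G \<bullet> x) *\<^sub>R x) \<bullet> x = 0" by (simp add: inner_diff_left)
  have "((\<lambda>y. - ((y - x) \<bullet> (y - x)) / 2) has_derivative (\<lambda>v. 0)) (at x within S2)"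
    by (auto intro!: derivative_eq_intros)
  then have flat: "((\<lambda>y. x \<bullet> y - 1) has_derivative (\<lambda>v. 0)) (at x within S2)"
  proof (rule has_derivative_transform[OF x, rotated])
    fix y :: "real ^ 3" assume "y \<in> S2"
    then have "y \<bullet> y = 1" by (simp add: dot_square_norm)
    with xx show "x \<bullet> y - 1 = - ((y - x) \<bullet> (y - x)) / 2"
      by (simp add: inner_diff_left inner_diff_right inner_commute[of y x] field_simps)
  qed
  have "((\<lambda>y. (h y - (G \<bullet> x) * (x \<bullet> y)) + (G \<bullet> x) * (x \<bullet> y - 1)) has_derivative
      (\<lambda>v. (G \<bullet> v - (G \<bullet> x) * (x \<bullet> v)) + (G \<bullet> x) * 0)) (at x within S2)"
    by (intro has_derivative_add has_derivative_diff has_derivative_at_withinI[OF h]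
        has_derivative_mult_right flat has_derivative_inner_right has_derivative_ident)
  then have "((\<lambda>y. h y - G \<bullet> x + 0) has_derivative (\<lambda>v. (G - (G \<bullet> x) *\<^sub>R x) \<bullet> v)) (at x within S2)"
    by (simp add: inner_diff_left algebra_simps)
  from has_derivative_add[OF this has_derivative_const[of "G \<bullet> x"]]
  show "(h has_derivative (\<lambda>v. (G - (G \<bullet> x) *\<^sub>R x) \<bullet> v)) (at x within S2)" by simp
qed

section \<open>Localised basis functions and their residuals\<close>

text \<open>
  The point of the closed orthant of the sphere at which the basis function of index \<open>J\<close> is
  concentrated: the mean \<open>n x\<^sub>i\<^sup>2\<close> of the multinomial distribution equals \<open>J\<^sub>i\<close> there.
\<close>

definition peak :: "nat \<Rightarrow> nat ^ 3 \<Rightarrow> real ^ 3" where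
  "peak n J = (\<chi> i. sqrt (real (J $ i) / real n))"

definition window :: "real \<Rightarrow> real ^ 3 \<Rightarrow> real ^ 3 \<Rightarrow> real" where
  "window \<rho> c x = cutoff (2 * (norm (x - c))\<^sup>2 / \<rho>\<^sup>2)"

text \<open>
  The strict inequality is the negation of the region \<open>s \<le> 1\<close> where the cutoff is constantly \<open>1\<close>.
  Hence \<open>1 - window\<close> and the gradient of the window both vanish unless \<open>far\<close> holds.
\<close>

definition far :: "real \<Rightarrow> real ^ 3 \<Rightarrow> real ^ 3 \<Rightarrow> bool" where
  "far \<rho> c x \<longleftrightarrow> \<rho>\<^sup>2 < 2 * (norm (x - c))\<^sup>2"

definition local_basis :: "nat \<Rightarrow> real \<Rightarrow> nat ^ 3 \<Rightarrow> real ^ 3 \<Rightarrow> real" where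
  "local_basis n \<rho> J x = window \<rho> (peak n J) x * kostlan_basis n J x"

definition residual_basis :: "nat \<Rightarrow> real \<Rightarrow> nat ^ 3 \<Rightarrow> real ^ 3 \<Rightarrow> real" where
  "residual_basis n \<rho> J x = (1 - window \<rho> (peak n J) x) * kostlan_basis n J x"

lemma window_eq_0:
  assumes "0 < \<rho>" "\<rho> \<le> norm (x - c)"
  shows "window \<rho> c x = 0"
proof -
  have "\<rho>\<^sup>2 \<le> (norm (x - c))\<^sup>2" using assms by (intro power_mono) auto
  then show ?thesis
    using assms(1) unfolding window_def by (intro cutoff_eq_0) (simp add: field_simps)
qed

lemma one_minus_window_bounds:
  assumes "0 < \<rho>"
  shows "0 \<le> 1 - window \<rho> c x" "1 - window \<rho> c x \<le> of_bool (far \<rho> c x)"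
proof -
  show "0 \<le> 1 - window \<rho> c x" using cutoff_bounds by (simp add: window_def)
  show "1 - window \<rho> c x \<le> of_bool (far \<rho> c x)"
  proof (cases "far \<rho> c x")
    case True
    then show ?thesis using cutoff_bounds by (simp add: window_def)
  next
    case False
    then have "window \<rho> c x = 1"
      using assms unfolding window_def far_def by (intro cutoff_eq_1) (simp add: field_simps)
    then show ?thesis by simp
  qed
qed

lemma smooth_fn_local_basis: "smooth_fn (local_basis n \<rho> J)"
proof -
  have "smooth_fn (\<lambda>x. (norm (x - peak n J))\<^sup>2 * (2 / \<rho>\<^sup>2))"
    by (intro smooth_fn.mult smooth_fn_dist_square smooth_fn.const)
  then have "smooth_fn (\<lambda>x. window \<rho> (peak n J) x)"
    unfolding window_def using smooth_fn_cutoff by (simp add: mult.commute)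
  moreover have "smooth_fn (\<lambda>x. kostlan_basis n J x)"
    unfolding kostlan_basis_def monomial_def
    by (intro smooth_fn.mult smooth_fn.const smooth_fn_prod smooth_fn_power smooth_fn_component)
  ultimately have "smooth_fn (\<lambda>x. window \<rho> (peak n J) x * kostlan_basis n J x)"
    by (rule smooth_fn.mult)
  then show ?thesis by (simp add: local_basis_def[abs_def])
qed

text \<open>
  By the triangle inequality one of the two points lies outside the window around the peak. This is
  the source of finite range dependence.
\<close>

lemma local_basis_disjoint:
  assumes "0 < \<rho>" "2 * \<rho> \<le> norm (x - y)"
  shows "local_basis n \<rho> J x * local_basis n \<rho> J y = 0"
proof -
  have "norm (x - y) \<le> norm (x - peak n J) + norm (y - peak n J)"
    using norm_triangle_ineq4[of "x - peak n J" "y - peak n J"] by simp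
  with assms have "\<rho> \<le> norm (x - peak n J) \<or> \<rho> \<le> norm (y - peak n J)" by linarith
  then show ?thesis using window_eq_0[OF assms(1)] by (auto simp: local_basis_def)
qed

text \<open>
  The distance to the peak is measured in the coordinates \<open>x\<^sub>i\<close>, the multinomial deviation in
  their squares; away from the coordinate planes the map \<open>x\<^sub>i \<mapsto> x\<^sub>i\<^sup>2\<close> contracts by at most the
  factor \<open>\<delta>\<close>. This is where the points have to stay inside the open orthant.
\<close>

lemma far_imp_deviation:
  assumes x: "\<And>i. \<delta> \<le> x $ i" "0 < \<delta>" and n: "n \<ge> 1" and far: "far \<rho> (peak n J) x"
  shows "\<exists>k. real n * (real n * \<rho>\<^sup>2 * \<delta>\<^sup>2 / 6) \<le> (real (J $ k) - real n * (x $ k)\<^sup>2)\<^sup>2"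
proof -
  define c where "c = peak n J"
  have "\<exists>k. \<rho>\<^sup>2 / 6 \<le> (x $ k - c $ k)\<^sup>2"
  proof (rule ccontr)
    assume "\<not> ?thesis"
    then have "(x $ k - c $ k)\<^sup>2 < \<rho>\<^sup>2 / 6" for k by (auto simp: not_le)
    then have "(x $ 1 - c $ 1)\<^sup>2 + (x $ 2 - c $ 2)\<^sup>2 + (x $ 3 - c $ 3)\<^sup>2 < \<rho>\<^sup>2 / 6 + \<rho>\<^sup>2 / 6 + \<rho>\<^sup>2 / 6"
      by (intro add_strict_mono)
    moreover have "(norm (x - c))\<^sup>2 = (x $ 1 - c $ 1)\<^sup>2 + (x $ 2 - c $ 2)\<^sup>2 + (x $ 3 - c $ 3)\<^sup>2"
      by (simp add: norm_vec_def L2_set_def sum_3)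
    ultimately show False using far by (simp add: far_def c_def)
  qed
  then obtain k where k: "\<rho>\<^sup>2 / 6 \<le> (x $ k - c $ k)\<^sup>2" ..
  have c: "0 \<le> c $ k" "real (J $ k) = real n * (c $ k)\<^sup>2"
    using n by (simp_all add: c_def peak_def)
  have "real n * (real n * \<rho>\<^sup>2 * \<delta>\<^sup>2 / 6) = (real n)\<^sup>2 * ((\<rho>\<^sup>2 / 6) * \<delta>\<^sup>2)"
    by (simp add: power2_eq_square)
  also have "\<dots> \<le> (real n)\<^sup>2 * ((x $ k - c $ k)\<^sup>2 * (x $ k + c $ k)\<^sup>2)"
    using x(1)[of k] x(2) c(1) k by (intro mult_left_mono mult_mono power_mono) auto
  also have "\<dots> = (real (J $ k) - real n * (x $ k)\<^sup>2)\<^sup>2"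
    unfolding c(2) by (simp add: power2_eq_square algebra_simps)
  finally show ?thesis by blast
qed

lemma far_mass:
  assumes x: "x \<in> S2" "\<And>i. \<delta> \<le> x $ i" "0 < \<delta>" and n: "n \<ge> 1"
  shows "(\<Sum>J\<in>multi_indices n. (kostlan_basis n J x)\<^sup>2 * of_bool (far \<rho> (peak n J) x))
    \<le> 6 * exp (- 2 * (real n * \<rho>\<^sup>2 * \<delta>\<^sup>2 / 6))"
proof -
  define t where "t = real n * \<rho>\<^sup>2 * \<delta>\<^sup>2 / 6"
  define dev where "dev = (\<lambda>(J :: nat ^ 3) k. real n * t \<le> (real (J $ k) - real n * (x $ k)\<^sup>2)\<^sup>2)"
  have t: "0 \<le> t" by (simp add: t_def)
  have pt: "of_bool (far \<rho> (peak n J) x) \<le> (\<Sum>k\<in>UNIV. of_bool (dev J k) :: real)" for J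
  proof (cases "far \<rho> (peak n J) x")
    case True
    then obtain k where "dev J k" using far_imp_deviation[OF x(2,3) n] by (auto simp: dev_def t_def)
    then show ?thesis
      using member_le_sum[of k UNIV "\<lambda>k. of_bool (dev J k) :: real"] by simp
  qed (simp add: sum_nonneg)
  have "(\<Sum>J\<in>multi_indices n. (kostlan_basis n J x)\<^sup>2 * of_bool (far \<rho> (peak n J) x))
      \<le> (\<Sum>J\<in>multi_indices n. (kostlan_basis n J x)\<^sup>2 * (\<Sum>k\<in>UNIV. of_bool (dev J k)))"
    by (intro sum_mono mult_left_mono pt) auto
  also have "\<dots> = (\<Sum>k\<in>UNIV. \<Sum>J\<in>multi_indices n. (kostlan_basis n J x)\<^sup>2 * of_bool (dev J k))"
    unfolding sum_distrib_left by (rule sum.swap)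
  also have "\<dots> \<le> (\<Sum>k\<in>(UNIV :: 3 set). 2 * exp (- 2 * t))"
    unfolding dev_def by (intro sum_mono kostlan_tail x n t)
  finally show ?thesis by (simp add: t_def)
qed

text \<open>
  The residual of index \<open>J\<close> is nonzero only at points far from the peak, and a product is at most
  half the sum of the squares. The sum is therefore at most the mean of the multinomial
  probabilities of the far indices at the two points.
\<close>

lemma residual_covariance_tail:
  assumes x: "x \<in> S2" "\<And>i. \<delta> \<le> x $ i" and y: "y \<in> S2" "\<And>i. \<delta> \<le> y $ i"
    and "0 < \<delta>" "n \<ge> 1" "0 < \<rho>"
  shows "\<bar>\<Sum>J\<in>multi_indices n. residual_basis n \<rho> J x * residual_basis n \<rho> J y\<bar>
    \<le> 6 * exp (- 2 * (real n * \<rho>\<^sup>2 * \<delta>\<^sup>2 / 6))"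
proof -
  define w where "w J z = (kostlan_basis n J z)\<^sup>2 * of_bool (far \<rho> (peak n J) z)" for J z
  have sq: "(residual_basis n \<rho> J z)\<^sup>2 \<le> w J z" for J z
  proof -
    have "(1 - window \<rho> (peak n J) z)\<^sup>2 \<le> (of_bool (far \<rho> (peak n J) z))\<^sup>2"
      using one_minus_window_bounds[OF \<open>0 < \<rho>\<close>] by (intro power_mono) auto
    then have "(1 - window \<rho> (peak n J) z)\<^sup>2 \<le> of_bool (far \<rho> (peak n J) z)"
      by (cases "far \<rho> (peak n J) z") simp_all
    from mult_left_mono[OF this, of "(kostlan_basis n J z)\<^sup>2"]
    show ?thesis by (simp add: w_def residual_basis_def power_mult_distrib mult.commute)
  qed
  have pt: "\<bar>residual_basis n \<rho> J x * residual_basis n \<rho> J y\<bar> \<le> (w J x + w J y) / 2" for J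
  proof -
    have "2 * \<bar>u * v\<bar> \<le> u\<^sup>2 + v\<^sup>2" for u v :: real
      using sum_squares_bound[of "\<bar>u\<bar>" "\<bar>v\<bar>"] by (simp add: abs_mult)
    from this[of "residual_basis n \<rho> J x" "residual_basis n \<rho> J y"]
    show ?thesis using sq[of J x] sq[of J y] by argo
  qed
  have "\<bar>\<Sum>J\<in>multi_indices n. residual_basis n \<rho> J x * residual_basis n \<rho> J y\<bar>
      \<le> (\<Sum>J\<in>multi_indices n. (w J x + w J y) / 2)"
    by (intro order_trans[OF sum_abs] sum_mono pt)
  also have "\<dots> = ((\<Sum>J\<in>multi_indices n. w J x) + (\<Sum>J\<in>multi_indices n. w J y)) / 2"
    by (simp add: sum.distrib flip: sum_divide_distrib)
  also have "\<dots> \<le> 6 * exp (- 2 * (real n * \<rho>\<^sup>2 * \<delta>\<^sup>2 / 6))"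
    using far_mass[OF x \<open>0 < \<delta>\<close> \<open>n \<ge> 1\<close>, of \<rho>, folded w_def]
      far_mass[OF y \<open>0 < \<delta>\<close> \<open>n \<ge> 1\<close>, of \<rho>, folded w_def] by argo
  finally show ?thesis .
qed

text \<open>
  In the orthant all basis functions are nonnegative, so removing a part of each of them can only
  decrease the covariance \<open>(x \<bullet> y) ^ n\<close> of the Kostlan ensemble.
\<close>

lemma residual_covariance_distance:
  assumes x: "x \<in> S2" "\<And>i. 0 \<le> x $ i" and y: "y \<in> S2" "\<And>i. 0 \<le> y $ i" and "0 < \<rho>"
  shows "\<bar>\<Sum>J\<in>multi_indices n. residual_basis n \<rho> J x * residual_basis n \<rho> J y\<bar>
    \<le> exp (- real n * (2 * (sphere_dist x y)\<^sup>2 / pi\<^sup>2))"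
proof -
  define s where "s = 2 * (sphere_dist x y)\<^sup>2 / pi\<^sup>2"
  have basis_nonneg: "0 \<le> kostlan_basis n J z" if "\<And>i. 0 \<le> z $ i" for J z
    using that by (auto simp: kostlan_basis_def monomial_def multinomial_def intro!: prod_nonneg mult_nonneg_nonneg divide_nonneg_nonneg)
  have res: "0 \<le> residual_basis n \<rho> J z" "residual_basis n \<rho> J z \<le> kostlan_basis n J z"
    if "\<And>i. 0 \<le> z $ i" for J z
  proof -
    note b = one_minus_window_bounds[OF \<open>0 < \<rho>\<close>, of "peak n J" z]
    have "1 - window \<rho> (peak n J) z \<le> 1" using b(2) by (cases "far \<rho> (peak n J) z") auto
    then show "0 \<le> residual_basis n \<rho> J z" "residual_basis n \<rho> J z \<le> kostlan_basis n J z"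
      using b(1) basis_nonneg[OF that] by (auto simp: residual_basis_def intro: mult_left_le_one_le)
  qed
  have "0 \<le> x \<bullet> y" using x(2) y(2) by (simp add: inner_vec_def sum_nonneg)
  have "\<bar>\<Sum>J\<in>multi_indices n. residual_basis n \<rho> J x * residual_basis n \<rho> J y\<bar> =
      (\<Sum>J\<in>multi_indices n. residual_basis n \<rho> J x * residual_basis n \<rho> J y)"
    using res(1) x(2) y(2) by (intro abs_of_nonneg sum_nonneg mult_nonneg_nonneg) auto
  also have "\<dots> \<le> (\<Sum>J\<in>multi_indices n. kostlan_basis n J x * kostlan_basis n J y)"
    using res x(2) y(2) basis_nonneg by (intro sum_mono mult_mono) auto
  also have "\<dots> = (x \<bullet> y) ^ n" by (rule sum_kostlan_basis_mult)
  also have "\<dots> \<le> exp (- s) ^ n"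
    using inner_le_sphere_dist[OF x(1) y(1)] exp_ge_add_one_self[of "- s"] \<open>0 \<le> x \<bullet> y\<close>
    by (intro power_mono) (auto simp: s_def)
  also have "\<dots> = exp (- real n * s)" by (simp flip: exp_of_nat_mult)
  finally show ?thesis by (simp add: s_def)
qed

section \<open>Gradients of the residuals\<close>

lemma norm_tangential_le:
  assumes "x \<in> S2"
  shows "norm (v - (v \<bullet> x) *\<^sub>R x) \<le> norm v"
proof (rule power2_le_imp_le)
  have "x \<bullet> x = 1" using assms by (simp add: dot_square_norm)
  then have "(norm (v - (v \<bullet> x) *\<^sub>R x))\<^sup>2 = (norm v)\<^sup>2 - (v \<bullet> x)\<^sup>2"
    unfolding power2_norm_eq_inner
    by (simp add: inner_diff_left inner_diff_right inner_commute[of x v] power2_eq_square)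
  then show "(norm (v - (v \<bullet> x) *\<^sub>R x))\<^sup>2 \<le> (norm v)\<^sup>2" by simp
qed simp

definition basis_gradient :: "nat \<Rightarrow> nat ^ 3 \<Rightarrow> real ^ 3 \<Rightarrow> real ^ 3" where
  "basis_gradient n J x = (\<chi> i. kostlan_basis n J x * real (J $ i) / x $ i)"

lemma kostlan_basis_has_derivative:
  assumes x: "\<And>i. 0 < x $ i"
  shows "(kostlan_basis n J has_derivative (\<lambda>v. basis_gradient n J x \<bullet> v)) (at x)"
proof -
  have "((\<lambda>x::real^3. (x $ i) ^ (J $ i)) has_derivative
      (\<lambda>v. real (J $ i) * v $ i * (x $ i) ^ (J $ i - 1))) (at x)" for i
    by (auto intro!: derivative_eq_intros bounded_linear_imp_has_derivative)
  then have "((\<lambda>x. sqrt (multinomial n J) * (\<Prod>i\<in>UNIV. (x $ i) ^ (J $ i))) has_derivative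
      (\<lambda>v. sqrt (multinomial n J) * (\<Sum>i\<in>UNIV. real (J $ i) * v $ i * (x $ i) ^ (J $ i - 1) *
        (\<Prod>j\<in>UNIV - {i}. (x $ j) ^ (J $ j))))) (at x)"
    by (intro has_derivative_mult_right has_derivative_prod)
  moreover have "sqrt (multinomial n J) * (\<Sum>i\<in>UNIV. real (J $ i) * v $ i * (x $ i) ^ (J $ i - 1) *
        (\<Prod>j\<in>UNIV - {i}. (x $ j) ^ (J $ j))) = basis_gradient n J x \<bullet> v" for v
  proof -
    have "real (J $ i) * v $ i * (x $ i) ^ (J $ i - 1) * (\<Prod>j\<in>UNIV - {i}. (x $ j) ^ (J $ j)) =
        monomial J x * real (J $ i) / x $ i * v $ i" for i
    proof -
      have "monomial J x = (x $ i) ^ (J $ i) * (\<Prod>j\<in>UNIV - {i}. (x $ j) ^ (J $ j))"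
        unfolding monomial_def by (intro prod.remove) auto
      moreover have "real (J $ i) * (x $ i) ^ (J $ i - 1) = (x $ i) ^ (J $ i) * real (J $ i) / x $ i"
        using x[of i] by (cases "J $ i") (auto simp: field_simps)
      ultimately show ?thesis by (simp add: mult_ac)
    qed
    then show ?thesis
      by (simp add: basis_gradient_def inner_vec_def sum_distrib_left kostlan_basis_def mult_ac)
  qed
  ultimately show ?thesis by (simp add: kostlan_basis_def[abs_def] monomial_def)
qed

text \<open>
  The Euclidean gradient has a radial part of size \<open>n\<close>. By Euler's identity for homogeneous
  polynomials, removing it centres the index \<open>J\<^sub>i\<close> at its mean \<open>n x\<^sub>i\<^sup>2\<close>, which leaves
  the basis function times multinomial fluctuations of size \<open>\<surd>n\<close>. This gives the factor \<open>n\<close>, rather than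
  \<open>n\<^sup>2\<close>, in the energy bound.
\<close>

lemma tangential_basis_gradient:
  assumes x: "x \<in> S2" "\<And>i. 0 < x $ i" and J: "J \<in> multi_indices n"
  shows "basis_gradient n J x - (basis_gradient n J x \<bullet> x) *\<^sub>R x =
    (\<chi> i. kostlan_basis n J x * (real (J $ i) - real n * (x $ i)\<^sup>2) / x $ i)"
proof -
  have nz: "x $ i \<noteq> 0" for i using x(2)[of i] by simp
  have "basis_gradient n J x \<bullet> x = kostlan_basis n J x * (\<Sum>i\<in>UNIV. real (J $ i))"
    using nz by (simp add: basis_gradient_def inner_vec_def sum_distrib_left)
  also have "(\<Sum>i\<in>UNIV. real (J $ i)) = real n"
    using J by (simp add: multi_indices_def flip: of_nat_sum)
  finally show ?thesis
    using nz by (simp add: vec_eq_iff basis_gradient_def field_simps power2_eq_square)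
qed

definition window_gradient :: "real \<Rightarrow> real ^ 3 \<Rightarrow> real ^ 3 \<Rightarrow> real ^ 3" where
  "window_gradient \<rho> c x = (cutoff_deriv (2 * (norm (x - c))\<^sup>2 / \<rho>\<^sup>2) * (4 / \<rho>\<^sup>2)) *\<^sub>R (x - c)"

lemma window_has_derivative:
  "(window \<rho> c has_derivative (\<lambda>v. window_gradient \<rho> c x \<bullet> v)) (at x)"
proof -
  have "((\<lambda>x. 2 * ((x - c) \<bullet> (x - c)) / \<rho>\<^sup>2) has_derivative (\<lambda>v. (4 / \<rho>\<^sup>2) * ((x - c) \<bullet> v))) (at x)"
  proof -
    have "((\<lambda>x. (2 / \<rho>\<^sup>2) * ((x - c) \<bullet> (x - c))) has_derivative
        (\<lambda>v. (2 / \<rho>\<^sup>2) * ((x - c) \<bullet> (v - 0) + (v - 0) \<bullet> (x - c)))) (at x)"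
      by (intro has_derivative_mult_right has_derivative_inner has_derivative_diff
          has_derivative_ident has_derivative_const)
    then show ?thesis by (simp add: inner_commute[of _ "x - c"])
  qed
  from has_derivative_compose[OF this cutoff_has_derivative[unfolded has_field_derivative_def]]
  show ?thesis
    by (simp add: window_def[abs_def] window_gradient_def power2_norm_eq_inner mult_ac)
qed

text \<open>
  Where the derivative of the cutoff does not vanish, \<open>x\<close> is within \<open>\<rho>\<close> of the centre. The constant
  is \<open>4 e\<^sup>2 \<cdot> 4 \<le> 36 \<cdot> 4\<close>.
\<close>

lemma norm_window_gradient_le:
  assumes "0 < \<rho>"
  shows "norm (window_gradient \<rho> c x) \<le> of_bool (far \<rho> c x) * (144 / \<rho>)"
proof -
  define s where "s = 2 * (norm (x - c))\<^sup>2 / \<rho>\<^sup>2"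
  show ?thesis
  proof (cases "1 < s \<and> s < 2")
    case False
    then show ?thesis
      using cutoff_deriv_eq_0[of s] assms by (auto simp: window_gradient_def s_def)
  next
    case True
    then have far: "far \<rho> c x" using assms by (simp add: far_def s_def field_simps)
    have "(norm (x - c))\<^sup>2 < \<rho>\<^sup>2" using True assms by (simp add: s_def field_simps)
    then have le: "norm (x - c) \<le> \<rho>"
      by (rule power2_le_imp_le[OF less_imp_le less_imp_le[OF assms]])
    have e: "(exp 1)\<^sup>2 \<le> (3::real)\<^sup>2" using exp_le by (intro power_mono) auto
    have "norm (window_gradient \<rho> c x) = \<bar>cutoff_deriv s\<bar> * (4 / \<rho>\<^sup>2) * norm (x - c)"
      by (simp add: window_gradient_def s_def abs_mult)
    also have "\<dots> \<le> 36 * (4 / \<rho>\<^sup>2) * \<rho>"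
      using abs_cutoff_deriv_le[of s] e le by (intro mult_mono) auto
    also have "\<dots> = 144 / \<rho>" using assms by (simp add: power2_eq_square)
    finally show ?thesis using far by simp
  qed
qed

definition residual_gradient :: "nat \<Rightarrow> real \<Rightarrow> nat ^ 3 \<Rightarrow> real ^ 3 \<Rightarrow> real ^ 3" where
  "residual_gradient n \<rho> J x = (1 - window \<rho> (peak n J) x) *\<^sub>R basis_gradient n J x
     - kostlan_basis n J x *\<^sub>R window_gradient \<rho> (peak n J) x"

lemma residual_basis_has_derivative:
  assumes x: "\<And>i. 0 < x $ i"
  shows "(residual_basis n \<rho> J has_derivative (\<lambda>v. residual_gradient n \<rho> J x \<bullet> v)) (at x)"
proof -
  have "((\<lambda>x. (1 - window \<rho> (peak n J) x) * kostlan_basis n J x) has_derivative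
     (\<lambda>v. (1 - window \<rho> (peak n J) x) * (basis_gradient n J x \<bullet> v) +
        (0 - window_gradient \<rho> (peak n J) x \<bullet> v) * kostlan_basis n J x)) (at x)"
    by (intro has_derivative_mult has_derivative_diff has_derivative_const
        window_has_derivative kostlan_basis_has_derivative x)
  then show ?thesis
    by (simp add: residual_basis_def[abs_def] residual_gradient_def inner_diff_left algebra_simps)
qed

lemma tangential_residual_gradient_bound:
  assumes x: "x \<in> S2" "\<And>i. \<delta> \<le> x $ i" "0 < \<delta>" and J: "J \<in> multi_indices n" and "0 < \<rho>"
  defines "W \<equiv> residual_gradient n \<rho> J x - (residual_gradient n \<rho> J x \<bullet> x) *\<^sub>R x"
  shows "(norm W)\<^sup>2 \<le> 2 / \<delta>\<^sup>2 * (\<Sum>k\<in>UNIV. (kostlan_basis n J x)\<^sup>2 *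
        (of_bool (far \<rho> (peak n J) x) * (real (J $ k) - real n * (x $ k)\<^sup>2)\<^sup>2))
     + 2 * (144 / \<rho>)\<^sup>2 * ((kostlan_basis n J x)\<^sup>2 * of_bool (far \<rho> (peak n J) x))"
proof -
  define u where "u = kostlan_basis n J x"
  define b :: real where "b = of_bool (far \<rho> (peak n J) x)"
  define G where "G = basis_gradient n J x - (basis_gradient n J x \<bullet> x) *\<^sub>R x"
  define L where "L = window_gradient \<rho> (peak n J) x - (window_gradient \<rho> (peak n J) x \<bullet> x) *\<^sub>R x"
  define \<theta> where "\<theta> = 1 - window \<rho> (peak n J) x"
  have bb: "b\<^sup>2 = b" "0 \<le> b" by (simp_all add: b_def)
  have pos: "0 < x $ i" for i using x(2)[of i] x(3) by linarith
  have W: "W = \<theta> *\<^sub>R G - u *\<^sub>R L"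
    by (simp add: W_def residual_gradient_def G_def L_def u_def \<theta>_def inner_diff_left algebra_simps)
  have two: "(norm (p - q))\<^sup>2 \<le> 2 * (norm p)\<^sup>2 + 2 * (norm q)\<^sup>2" for p q :: "real ^ 3"
  proof -
    have "(norm (p - q))\<^sup>2 + (norm (p + q))\<^sup>2 = 2 * (norm p)\<^sup>2 + 2 * (norm q)\<^sup>2"
      unfolding power2_norm_eq_inner by (simp add: inner_diff_left inner_diff_right inner_add_left inner_add_right)
    then show ?thesis using zero_le_power2[of "norm (p + q)"] by linarith
  qed
  have G: "(norm G)\<^sup>2 \<le> 1 / \<delta>\<^sup>2 * (\<Sum>k\<in>UNIV. u\<^sup>2 * (real (J $ k) - real n * (x $ k)\<^sup>2)\<^sup>2)"
  proof -
    have "(norm G)\<^sup>2 = (\<Sum>k\<in>UNIV. (u * (real (J $ k) - real n * (x $ k)\<^sup>2) / x $ k)\<^sup>2)"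
      unfolding G_def tangential_basis_gradient[OF x(1) pos J]
      by (simp add: norm_vec_def L2_set_def sum_nonneg u_def power_divide)
    also have "\<dots> \<le> (\<Sum>k\<in>UNIV. 1 / \<delta>\<^sup>2 * (u\<^sup>2 * (real (J $ k) - real n * (x $ k)\<^sup>2)\<^sup>2))"
    proof (intro sum_mono)
      fix k
      have "\<delta>\<^sup>2 \<le> (x $ k)\<^sup>2" using x(2,3) by (intro power_mono) auto
      then have "u\<^sup>2 * (real (J $ k) - real n * (x $ k)\<^sup>2)\<^sup>2 / (x $ k)\<^sup>2 \<le>
          u\<^sup>2 * (real (J $ k) - real n * (x $ k)\<^sup>2)\<^sup>2 / \<delta>\<^sup>2"
        using x(3) pos[of k] by (intro divide_left_mono) auto
      then show "(u * (real (J $ k) - real n * (x $ k)\<^sup>2) / x $ k)\<^sup>2 \<le>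
          1 / \<delta>\<^sup>2 * (u\<^sup>2 * (real (J $ k) - real n * (x $ k)\<^sup>2)\<^sup>2)"
        by (simp add: power_divide power_mult_distrib)
    qed
    finally show ?thesis by (simp only: sum_distrib_left)
  qed
  have \<theta>: "\<theta>\<^sup>2 \<le> b"
  proof -
    have "\<theta>\<^sup>2 \<le> b\<^sup>2"
      using one_minus_window_bounds[OF \<open>0 < \<rho>\<close>] unfolding \<theta>_def b_def by (intro power_mono)
    then show ?thesis by (simp add: bb)
  qed
  have L: "(norm L)\<^sup>2 \<le> b * (144 / \<rho>)\<^sup>2"
  proof -
    have "norm L \<le> b * (144 / \<rho>)"
      unfolding L_def b_def
      by (rule order_trans[OF norm_tangential_le[OF x(1)] norm_window_gradient_le[OF \<open>0 < \<rho>\<close>]])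
    then have "(norm L)\<^sup>2 \<le> (b * (144 / \<rho>))\<^sup>2" by (intro power_mono) auto
    then show ?thesis by (simp only: power_mult_distrib bb)
  qed
  have "(norm W)\<^sup>2 \<le> 2 * (\<theta>\<^sup>2 * (norm G)\<^sup>2) + 2 * (u\<^sup>2 * (norm L)\<^sup>2)"
    using two[of "\<theta> *\<^sub>R G" "u *\<^sub>R L"] by (simp add: W power_mult_distrib)
  also have "\<dots> \<le> 2 * (b * (1 / \<delta>\<^sup>2 * (\<Sum>k\<in>UNIV. u\<^sup>2 * (real (J $ k) - real n * (x $ k)\<^sup>2)\<^sup>2)))
      + 2 * (u\<^sup>2 * (b * (144 / \<rho>)\<^sup>2))"
    by (intro add_mono mult_left_mono mult_mono \<theta> G L bb) auto
  also have "\<dots> = 2 / \<delta>\<^sup>2 * (\<Sum>k\<in>UNIV. u\<^sup>2 * (b * (real (J $ k) - real n * (x $ k)\<^sup>2)\<^sup>2))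
      + 2 * (144 / \<rho>)\<^sup>2 * (u\<^sup>2 * b)"
  proof -
    have "(\<Sum>k\<in>UNIV. u\<^sup>2 * (b * (real (J $ k) - real n * (x $ k)\<^sup>2)\<^sup>2)) =
        b * (\<Sum>k\<in>UNIV. u\<^sup>2 * (real (J $ k) - real n * (x $ k)\<^sup>2)\<^sup>2)"
      unfolding sum_distrib_left by (intro sum.cong refl) (rule mult.left_commute)
    then show ?thesis by simp
  qed
  finally show ?thesis unfolding u_def b_def .
qed

lemma residual_gradient_energy:
  assumes x: "x \<in> S2" "\<And>i. \<delta> \<le> x $ i" "0 < \<delta>" and n: "n \<ge> 1" and "0 < \<rho>"
  defines "t \<equiv> real n * \<rho>\<^sup>2 * \<delta>\<^sup>2 / 6"
  shows "(\<Sum>J\<in>multi_indices n. (norm (residual_gradient n \<rho> J x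
      - (residual_gradient n \<rho> J x \<bullet> x) *\<^sub>R x))\<^sup>2)
    \<le> (1170 / \<delta>\<^sup>2 * real n + 12 * 144\<^sup>2 / \<rho>\<^sup>2) * exp (- t)"
proof -
  define B where "B J = (kostlan_basis n J x)\<^sup>2 * of_bool (far \<rho> (peak n J) x)" for J
  define Y where "Y J k = (kostlan_basis n J x)\<^sup>2 *
      (of_bool (far \<rho> (peak n J) x) * (real (J $ k) - real n * (x $ k)\<^sup>2)\<^sup>2)" for J k
  have mass: "(\<Sum>J\<in>multi_indices n. B J) \<le> 6 * exp (- 2 * t)"
    unfolding t_def B_def by (rule far_mass[OF x n])
  also have "\<dots> \<le> 6 * exp (- t)" by (simp add: t_def)
  finally have mass': "(\<Sum>J\<in>multi_indices n. B J) \<le> 6 * exp (- t)" .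
  have moment: "(\<Sum>J\<in>multi_indices n. Y J k) \<le> 195 * real n * exp (- t)" for k
    unfolding Y_def by (rule kostlan_truncated_second_moment[OF x(1) n mass[unfolded B_def]])
  have "(\<Sum>J\<in>multi_indices n. (norm (residual_gradient n \<rho> J x
      - (residual_gradient n \<rho> J x \<bullet> x) *\<^sub>R x))\<^sup>2)
    \<le> (\<Sum>J\<in>multi_indices n. 2 / \<delta>\<^sup>2 * (\<Sum>k\<in>UNIV. Y J k) + 2 * (144 / \<rho>)\<^sup>2 * B J)"
    unfolding Y_def B_def by (intro sum_mono tangential_residual_gradient_bound x \<open>0 < \<rho>\<close>)
  also have "\<dots> = 2 / \<delta>\<^sup>2 * (\<Sum>J\<in>multi_indices n. \<Sum>k\<in>UNIV. Y J k)
      + 2 * (144 / \<rho>)\<^sup>2 * (\<Sum>J\<in>multi_indices n. B J)"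
    by (simp only: sum.distrib sum_distrib_left)
  also have "(\<Sum>J\<in>multi_indices n. \<Sum>k\<in>UNIV. Y J k) = (\<Sum>k\<in>UNIV. \<Sum>J\<in>multi_indices n. Y J k)"
    by (rule sum.swap)
  also have "2 / \<delta>\<^sup>2 * (\<Sum>k\<in>UNIV. \<Sum>J\<in>multi_indices n. Y J k)
      + 2 * (144 / \<rho>)\<^sup>2 * (\<Sum>J\<in>multi_indices n. B J)
    \<le> 2 / \<delta>\<^sup>2 * (\<Sum>k\<in>(UNIV :: 3 set). 195 * real n * exp (- t)) + 2 * (144 / \<rho>)\<^sup>2 * (6 * exp (- t))"
    by (intro add_mono mult_left_mono sum_mono moment mass') auto
  also have "\<dots> = (1170 / \<delta>\<^sup>2 * real n + 12 * 144\<^sup>2 / \<rho>\<^sup>2) * exp (- t)"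
    by (simp add: power_divide distrib_right)
  finally show ?thesis .
qed

section \<open>The coupling\<close>

text \<open>
  The field \<open>f\<^sub>n\<^sup>(\<^sup>r\<^sup>)\<close>: the Gaussian coefficients are those of the Kostlan ensemble, and each basis
  function is cut off around its peak.
\<close>

definition local_field ::
    "nat \<Rightarrow> real \<Rightarrow> (nat ^ 3 \<Rightarrow> 'w \<Rightarrow> real) \<Rightarrow> real ^ 3 \<Rightarrow> 'w \<Rightarrow> real" where
  "local_field n \<rho> a x \<omega> = (\<Sum>J\<in>multi_indices n. local_basis n \<rho> J x * a J \<omega>)"

lemma kostlan_minus_local_field:
  "kostlan n a x \<omega> - local_field n \<rho> a x \<omega> = (\<Sum>J\<in>multi_indices n. residual_basis n \<rho> J x * a J \<omega>)"
  by (simp add: kostlan_def local_field_def residual_basis_def local_basis_def kostlan_basis_def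
      algebra_simps flip: sum_subtractf)

text \<open>
  With \<open>\<rho> = r / \<pi>\<close>, points at spherical distance \<open>r\<close> have Euclidean distance at least
  \<open>2 r / \<pi> = 2 \<rho>\<close>, the separation at which localised basis functions become disjoint.
\<close>

lemma kostlan_coupling_local_field:
  assumes "standard_gaussians M a (multi_indices n)" and r: "0 < r"
  shows "kostlan_coupling n M a (local_field n (r / pi) a) r"
proof -
  interpret standard_gaussians M a "multi_indices n" by fact
  have "gaussian_field_S2 M (local_field n (r / pi) a)"
    unfolding gaussian_field_S2_def
  proof (intro allI impI)
    fix F :: "(real ^ 3) set" and b :: "real ^ 3 \<Rightarrow> real"
    have "(\<Sum>x\<in>F. b x * local_field n (r / pi) a x \<omega>) =
        (\<Sum>J\<in>multi_indices n. (\<Sum>x\<in>F. b x * local_basis n (r / pi) J x) * a J \<omega>)" for \<omega>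
      unfolding local_field_def sum_distrib_left sum_distrib_right
      by (subst sum.swap) (simp only: mult.assoc)
    then show "gaussian_rv M (\<lambda>\<omega>. \<Sum>x\<in>F. b x * local_field n (r / pi) a x \<omega>)"
      by (simp only: gaussian_linear_combination)
  qed
  moreover have "smooth_field_S2 M (local_field n (r / pi) a)"
    unfolding smooth_field_S2_def local_field_def
    by (intro ballI smooth_fn_imp_smooth_on_S2 smooth_fn_sum smooth_fn.mult smooth_fn_local_basis smooth_fn.const)
  moreover have "range_dependent_S2 M (local_field n (r / pi) a) r"
    unfolding range_dependent_S2_def
  proof (intro ballI impI)
    fix x y assume xy: "x \<in> S2" "y \<in> S2" "r \<le> sphere_dist x y"
    have "2 * (r / pi) \<le> 2 * sphere_dist x y / pi" using xy(3) by (simp add: divide_right_mono)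
    also have "\<dots> \<le> norm (x - y)" by (rule norm_diff_ge_sphere_dist[OF xy(1,2)])
    finally have "local_basis n (r / pi) J x * local_basis n (r / pi) J y = 0" for J
      using r by (intro local_basis_disjoint) auto
    then show "covariance M (local_field n (r / pi) a x) (local_field n (r / pi) a y) = 0"
      unfolding local_field_def covariance_linear_combinations by (intro sum.neutral) auto
  qed
  ultimately show ?thesis
    using prob_space_axioms indep std_normal by (simp add: kostlan_coupling_def kostlan_coeffs_def)
qed

lemma sphere_grad_residual:
  assumes x: "x \<in> S2" "\<And>i. 0 < x $ i"
  shows "sphere_grad (\<lambda>z. kostlan n a z \<omega> - local_field n \<rho> a z \<omega>) x =
    (\<Sum>J\<in>multi_indices n. a J \<omega> *\<^sub>R (residual_gradient n \<rho> J x
      - (residual_gradient n \<rho> J x \<bullet> x) *\<^sub>R x))"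
proof -
  define G where "G = (\<Sum>J\<in>multi_indices n. a J \<omega> *\<^sub>R residual_gradient n \<rho> J x)"
  have "((\<lambda>z. \<Sum>J\<in>multi_indices n. a J \<omega> * residual_basis n \<rho> J z) has_derivative
      (\<lambda>v. \<Sum>J\<in>multi_indices n. a J \<omega> * (residual_gradient n \<rho> J x \<bullet> v))) (at x)"
    by (intro has_derivative_sum has_derivative_mult_right residual_basis_has_derivative x(2))
  then have "((\<lambda>z. kostlan n a z \<omega> - local_field n \<rho> a z \<omega>) has_derivative (\<lambda>v. G \<bullet> v)) (at x)"
    by (simp add: kostlan_minus_local_field G_def inner_sum_left mult.commute)
  from sphere_grad_eq_tangential_part[OF x(1) this]
  show ?thesis
    by (simp add: G_def inner_sum_left scaleR_sum_left sum_subtractf scaleR_diff_right)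
qed

lemma compact_orthant_lower_bound:
  fixes U :: "(real ^ 'n) set"
  assumes "compact U" and pos: "\<And>x i. x \<in> U \<Longrightarrow> 0 < x $ i"
  obtains \<delta> where "0 < \<delta>" "\<And>x i. x \<in> U \<Longrightarrow> \<delta> \<le> x $ i"
proof -
  have "\<exists>d>0. \<forall>x\<in>U. d \<le> x $ i" for i
  proof (cases "U = {}")
    case False
    have "continuous_on U (\<lambda>x. x $ i)" by (intro continuous_intros)
    from continuous_attains_inf[OF \<open>compact U\<close> False this] obtain m
      where "m \<in> U" "\<forall>y\<in>U. m $ i \<le> y $ i" by blast
    then show ?thesis using pos by blast
  qed (auto intro: exI[of _ 1])
  then obtain d where d: "\<And>i. 0 < d i" "\<And>i x. x \<in> U \<Longrightarrow> d i \<le> x $ i" by metis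
  show thesis
  proof (rule that)
    show "0 < Min (range d)" using d(1) by (subst Min_gr_iff) auto
    show "Min (range d) \<le> x $ i" if "x \<in> U" for x i
      using d(2)[OF that, of i] by (meson Min_le finite_imageI finite rangeI order_trans)
  qed
qed

theorem proposition3p5:
  fixes U :: "(real ^ 3) set"
  assumes "compact U" and "U \<subseteq> S2 \<inter> open_orthant"
  shows "\<exists>c1 c2 :: real. c1 > 0 \<and> c2 > 0 \<and>
    (\<forall>(n::nat) (r::real). n \<ge> 1 \<longrightarrow> r \<ge> 1 / sqrt (real n) \<longrightarrow>
      (\<exists>M a g. kostlan_coupling n M a g r \<and>
        (let D = (\<lambda>x \<omega>. kostlan n a x \<omega> - g x \<omega>) in
          (\<forall>x\<in>U. \<forall>y\<in>U. \<bar>covariance M (D x) (D y)\<bar>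
             \<le> c1 * exp (- c2 * real n * max (r\<^sup>2) ((sphere_dist x y)\<^sup>2))) \<and>
          (\<forall>x\<in>U. integrable M (\<lambda>\<omega>. (norm (sphere_grad (\<lambda>z. D z \<omega>) x))\<^sup>2) \<and>
             (\<integral>\<omega>. (norm (sphere_grad (\<lambda>z. D z \<omega>) x))\<^sup>2 \<partial>M)
               \<le> c1 * real n * exp (- c2 * real n * r\<^sup>2)))))"
proof -
  have US: "x \<in> S2" "0 < x $ i" if "x \<in> U" for x i
    using that assms(2) by (auto simp: open_orthant_def)
  obtain \<delta> where \<delta>: "0 < \<delta>" "\<And>x i. x \<in> U \<Longrightarrow> \<delta> \<le> x $ i"
    using compact_orthant_lower_bound[OF assms(1) US(2)] by blast
  \<comment> \<open>With \<open>\<rho> = r / \<pi>\<close> the tail exponent \<open>n \<rho>\<^sup>2 \<delta>\<^sup>2 / 6\<close> is \<open>n r\<^sup>2\<close> times the second term of \<open>c2\<close>.\<close>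
  define c1 where "c1 = 6 + (1170 / \<delta>\<^sup>2 + 12 * 144\<^sup>2 * pi\<^sup>2)"
  define c2 where "c2 = min (2 / pi\<^sup>2) (\<delta>\<^sup>2 / (6 * pi\<^sup>2))"
  have c1: "6 \<le> c1" "1170 / \<delta>\<^sup>2 + 12 * 144\<^sup>2 * pi\<^sup>2 \<le> c1" by (simp_all add: c1_def)
  have c2: "0 < c2" "c2 \<le> 2 / pi\<^sup>2" "c2 \<le> \<delta>\<^sup>2 / (6 * pi\<^sup>2)" using \<delta>(1) by (auto simp: c2_def)
  have main: "\<exists>M a g. kostlan_coupling n M a g r \<and>
        (let D = (\<lambda>x \<omega>. kostlan n a x \<omega> - g x \<omega>) in
          (\<forall>x\<in>U. \<forall>y\<in>U. \<bar>covariance M (D x) (D y)\<bar>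
             \<le> c1 * exp (- c2 * real n * max (r\<^sup>2) ((sphere_dist x y)\<^sup>2))) \<and>
          (\<forall>x\<in>U. integrable M (\<lambda>\<omega>. (norm (sphere_grad (\<lambda>z. D z \<omega>) x))\<^sup>2) \<and>
             (\<integral>\<omega>. (norm (sphere_grad (\<lambda>z. D z \<omega>) x))\<^sup>2 \<partial>M)
               \<le> c1 * real n * exp (- c2 * real n * r\<^sup>2)))"
    if n: "n \<ge> 1" and r: "r \<ge> 1 / sqrt (real n)" for n :: nat and r :: real
  proof -
    have "0 < 1 / sqrt (real n)" using n by simp
    with r have r0: "0 < r" by (rule less_le_trans[rotated])
    define \<rho> where "\<rho> = r / pi"
    have \<rho>: "0 < \<rho>" using r0 by (simp add: \<rho>_def)
    define t where "t = real n * \<rho>\<^sup>2 * \<delta>\<^sup>2 / 6"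
    have t: "c2 * real n * r\<^sup>2 \<le> t"
    proof -
      have "c2 * (real n * r\<^sup>2) \<le> \<delta>\<^sup>2 / (6 * pi\<^sup>2) * (real n * r\<^sup>2)"
        using c2(3) by (intro mult_right_mono) auto
      also have "\<dots> = t" by (simp add: t_def \<rho>_def power_divide mult_ac)
      finally show ?thesis by (simp add: mult.assoc)
    qed
    define a :: "nat ^ 3 \<Rightarrow> (nat \<Rightarrow> real) \<Rightarrow> real" where "a = (\<lambda>J \<omega>. \<omega> (to_nat J))"
    have "multi_indices n \<noteq> {}"
    proof -
      have "(\<chi> i. if i = 1 then n else 0) \<in> multi_indices n" by (simp add: multi_indices_def)
      then show ?thesis by blast
    qed
    then interpret standard_gaussians gaussian_sequence_space a "multi_indices n"
      unfolding a_def by (intro standard_gaussians_coordinates finite_multi_indices)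
    define D where "D = (\<lambda>x \<omega>. kostlan n a x \<omega> - local_field n \<rho> a x \<omega>)"
    have D: "D x = (\<lambda>\<omega>. \<Sum>J\<in>multi_indices n. residual_basis n \<rho> J x * a J \<omega>)" for x
      unfolding D_def by (rule ext) (rule kostlan_minus_local_field)
    have cov: "\<bar>covariance gaussian_sequence_space (D x) (D y)\<bar>
        \<le> c1 * exp (- c2 * real n * max (r\<^sup>2) ((sphere_dist x y)\<^sup>2))"
      if x: "x \<in> U" and y: "y \<in> U" for x y
    proof -
      define C where "C = \<bar>covariance gaussian_sequence_space (D x) (D y)\<bar>"
      have "C \<le> 6 * exp (- 2 * t)"
        unfolding C_def D covariance_linear_combinations t_def
        by (intro residual_covariance_tail US \<delta> x y n \<rho>)
      also have "\<dots> \<le> c1 * exp (- c2 * real n * r\<^sup>2)"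
      proof (intro mult_mono)
        have "0 \<le> t" by (simp add: t_def)
        with t show "exp (- 2 * t) \<le> exp (- c2 * real n * r\<^sup>2)" by simp
      qed (use c1 in auto)
      finally have tail: "C \<le> c1 * exp (- c2 * real n * r\<^sup>2)" .
      have "C \<le> exp (- real n * (2 * (sphere_dist x y)\<^sup>2 / pi\<^sup>2))"
        unfolding C_def D covariance_linear_combinations
        using US[OF x] US[OF y] by (intro residual_covariance_distance \<rho>) (auto intro: less_imp_le)
      also have "\<dots> \<le> 1 * exp (- c2 * real n * (sphere_dist x y)\<^sup>2)"
      proof -
        have "c2 * (real n * (sphere_dist x y)\<^sup>2) \<le> 2 / pi\<^sup>2 * (real n * (sphere_dist x y)\<^sup>2)"
          using c2(2) by (intro mult_right_mono) auto
        then show ?thesis by (simp add: mult_ac)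
      qed
      also have "\<dots> \<le> c1 * exp (- c2 * real n * (sphere_dist x y)\<^sup>2)"
        using c1(1) by (intro mult_right_mono) auto
      finally show ?thesis using tail unfolding C_def max_def by simp
    qed
    have grad: "integrable gaussian_sequence_space (\<lambda>\<omega>. (norm (sphere_grad (\<lambda>z. D z \<omega>) x))\<^sup>2)"
      "(\<integral>\<omega>. (norm (sphere_grad (\<lambda>z. D z \<omega>) x))\<^sup>2 \<partial>gaussian_sequence_space)
        \<le> c1 * real n * exp (- c2 * real n * r\<^sup>2)"
      if x: "x \<in> U" for x
    proof -
      define W where "W J = residual_gradient n \<rho> J x - (residual_gradient n \<rho> J x \<bullet> x) *\<^sub>R x" for J
      have g: "sphere_grad (\<lambda>z. D z \<omega>) x = (\<Sum>J\<in>multi_indices n. a J \<omega> *\<^sub>R W J)" for \<omega>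
        unfolding D_def W_def by (rule sphere_grad_residual[OF US[OF x]])
      show "integrable gaussian_sequence_space (\<lambda>\<omega>. (norm (sphere_grad (\<lambda>z. D z \<omega>) x))\<^sup>2)"
        unfolding g by (rule norm_square_vector_combination)
      have "(\<integral>\<omega>. (norm (sphere_grad (\<lambda>z. D z \<omega>) x))\<^sup>2 \<partial>gaussian_sequence_space)
          = (\<Sum>J\<in>multi_indices n. (norm (W J))\<^sup>2)"
        unfolding g by (rule norm_square_vector_combination)
      also have "\<dots> \<le> (1170 / \<delta>\<^sup>2 * real n + 12 * 144\<^sup>2 / \<rho>\<^sup>2) * exp (- t)"
        unfolding W_def t_def by (rule residual_gradient_energy[OF US(1)[OF x] \<delta>(2)[OF x] \<delta>(1) n \<rho>])
      also have "\<dots> \<le> (c1 * real n) * exp (- c2 * real n * r\<^sup>2)"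
      proof (intro mult_mono)
        \<comment> \<open>The assumed lower bound on \<open>r\<close> keeps the window gradient, of order \<open>1 / r\<close>, below order \<open>\<surd>n\<close>.\<close>
        have "(1 / sqrt (real n))\<^sup>2 \<le> r\<^sup>2" using r by (intro power_mono) auto
        then have "1 / r\<^sup>2 \<le> real n"
          using n r0 by (simp add: power_divide field_simps)
        then have "12 * 144\<^sup>2 * pi\<^sup>2 * (1 / r\<^sup>2) \<le> 12 * 144\<^sup>2 * pi\<^sup>2 * real n"
          by (intro mult_left_mono) auto
        then have "1170 / \<delta>\<^sup>2 * real n + 12 * 144\<^sup>2 / \<rho>\<^sup>2
            \<le> (1170 / \<delta>\<^sup>2 + 12 * 144\<^sup>2 * pi\<^sup>2) * real n"
          by (simp add: \<rho>_def power_divide distrib_right)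
        also have "\<dots> \<le> c1 * real n" using c1(2) by (intro mult_right_mono) auto
        finally show "1170 / \<delta>\<^sup>2 * real n + 12 * 144\<^sup>2 / \<rho>\<^sup>2 \<le> c1 * real n" .
      qed (use t c1 in auto)
      finally show "(\<integral>\<omega>. (norm (sphere_grad (\<lambda>z. D z \<omega>) x))\<^sup>2 \<partial>gaussian_sequence_space)
        \<le> c1 * real n * exp (- c2 * real n * r\<^sup>2)" .
    qed
    have "kostlan_coupling n gaussian_sequence_space a (local_field n \<rho> a) r"
      unfolding \<rho>_def using standard_gaussians_axioms r0 by (rule kostlan_coupling_local_field)
    then show ?thesis
      unfolding Let_def using cov grad unfolding D_def by blast
  qed
  show ?thesis
    using c1(1) c2(1) main by (intro exI[of _ c1] exI[of _ c2]) auto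
qed

end
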